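(* Let $\mathcal{Q}_{kp}$ be the $8$-dimensional Kac–Paljutkin Hopf $*$-algebra and let $\widehat{\mathcal{Q}}_{kp}$ be its dual Hopf $*$-algebra. Then both groups $H^{2}_{uinv}(\widehat{\mathcal{Q}}_{kp},S^{1})$ and $H^{2}_{inv}(\widehat{\mathcal{Q}}_{kp},\mathbb{C}\setminus\{0\})$ are trivial.
   Context: The Kac–Paljutkin algebra $\mathcal{Q}_{kp}$ is the unique $8$-dimensional semisimple complex Hopf algebra (finite quantum group) that is neither commutative nor cocommutative. Explicitly, it is generated by $x,y,z$ with $x^2=y^2=1$, $xy=yx$, $zx=yz$, $zy=xz$, $z^2=\frac12(1+x+y-xy)$, coproduct $\Delta(x)=x\otimes x$, $\Delta(y)=y\otimes y$, $\Delta(z)=\frac12(1\otimes1+1\otimes x+y\otimes1-y\otimes x)(z\otimes z)$, and involution $x^*=x$, $y^*=y$, $z^*=z^{-1}$. Its representation category is the Tambara–Yamagami category associated with the Klein four-group $K_4=\mathbb{Z}_2\oplus\mathbb{Z}_2$ (generators $a,b$), the nondegenerate symmetric bicharacter $\chi_c$ with $\chi_c(a,a)=\chi_c(b,b)=-1$, $\chi_c(a,b)=1$, and the parameter $\tau=\frac12$. The dual $\widehat{\mathcal{Q}}_{kp}$ is the linear dual with the dual Hopf $*$-algebra structure. For a finite-dimensional Hopf $*$-algebra $(\mathcal{Q},\Delta)$: a (left) 2-cocycle is an invertible element $\Omega\in\mathcal{Q}\otimes\mathcal{Q}$ such that $(1\otimes\Omega)(\mathrm{id}\otimes\Delta)(\Omega)=(\Omega\otimes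 1)(\Delta\otimes\mathrm{id})(\Omega)$. It is called invariant if it commutes with $\Delta(a)$ for every $a\in\mathcal{Q}$, and unitary if it is a unitary element of $\mathcal{Q}\otimes\mathcal{Q}$. Let $A^{1}(\mathcal{Q})$ (resp. $A^{1}_{u}(\mathcal{Q})$) be the group of central invertible (resp. central unitary) elements of $\mathcal{Q}$, and let $A^{2}(\mathcal{Q})$ (resp. $A^{2}_{u}(\mathcal{Q})$) be the group, under multiplication in $\mathcal{Q}\otimes\mathcal{Q}$, of invariant (resp. invariant unitary) 2-cocycles. The map $\delta(v)=(v\otimes v)\Delta(v^{-1})$ defines group homomorphisms $A^{1}(\mathcal{Q})\to A^{2}(\mathcal{Q})$ and $A^{1}_{u}(\mathcal{Q})\to A^{2}_{u}(\mathcal{Q})$ with central image. Define $H^{2}_{inv}(\mathcal{Q},\mathbb{C}\setminus\{0\})=A^{2}(\mathcal{Q})/\delta(A^{1}(\mathcal{Q}))$ and $H^{2}_{uinv}(\mathcal{Q},S^{1})=A^{2}_{u}(\mathcal{Q})/\delta(A^{1}_{u}(\mathcal{Q}))$. *)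

theory Defs
  imports Complex_Main "HOL-Algebra.Elementary_Groups"
begin

section \<open>Finite-dimensional Hopf star-algebras in coordinates\<close>

text \<open>
  A finite-dimensional complex algebra is given by its structure constants with respect to a basis
  \<open>e\<^sub>i\<close> indexed by a finite type \<open>'i\<close>:
  \<open>e\<^sub>i e\<^sub>j = \<Sum>\<^sub>k mult_coeff i j k e\<^sub>k\<close>, \<open>1 = \<Sum>\<^sub>k unit_coeff k e\<^sub>k\<close>, \<open>e\<^sub>i\<^sup>* = \<Sum>\<^sub>j star_coeff i j e\<^sub>j\<close>,
  \<open>\<Delta>(e\<^sub>i) = \<Sum>\<^sub>j\<^sub>k comult_coeff i j k e\<^sub>j \<otimes> e\<^sub>k\<close>, \<open>S(e\<^sub>i) = \<Sum>\<^sub>j antipode_coeff i j e\<^sub>j\<close>.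
  Elements of the algebra are coordinate functions \<open>'i \<Rightarrow> complex\<close>; the tensor product of the algebras
  with bases indexed by \<open>'i\<close> and \<open>'j\<close> has its basis indexed by \<open>'i \<times> 'j\<close>.
\<close>

record 'i star_alg =
  mult_coeff :: "'i \<Rightarrow> 'i \<Rightarrow> 'i \<Rightarrow> complex"
  unit_coeff :: "'i \<Rightarrow> complex"
  star_coeff :: "'i \<Rightarrow> 'i \<Rightarrow> complex"

record 'i hopf_star_alg = "'i star_alg" +
  comult_coeff :: "'i \<Rightarrow> 'i \<Rightarrow> 'i \<Rightarrow> complex"
  counit_coeff :: "'i \<Rightarrow> complex"
  antipode_coeff :: "'i \<Rightarrow> 'i \<Rightarrow> complex"

definition basis_vec :: "'i \<Rightarrow> 'i \<Rightarrow> complex" where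
  "basis_vec i = (\<lambda>j. if j = i then 1 else 0)"

definition alg_mult :: "('i::finite, 'm) star_alg_scheme \<Rightarrow> ('i \<Rightarrow> complex) \<Rightarrow> ('i \<Rightarrow> complex) \<Rightarrow> 'i \<Rightarrow> complex" where
  "alg_mult A a b = (\<lambda>k. \<Sum>i\<in>UNIV. \<Sum>j\<in>UNIV. a i * b j * mult_coeff A i j k)"

definition alg_star :: "('i::finite, 'm) star_alg_scheme \<Rightarrow> ('i \<Rightarrow> complex) \<Rightarrow> 'i \<Rightarrow> complex" where
  "alg_star A a = (\<lambda>j. \<Sum>i\<in>UNIV. cnj (a i) * star_coeff A i j)"

definition tensor_vec :: "('i \<Rightarrow> complex) \<Rightarrow> ('j \<Rightarrow> complex) \<Rightarrow> 'i \<times> 'j \<Rightarrow> complex" where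
  "tensor_vec a b = (\<lambda>(i, j). a i * b j)"

definition tensor_alg ::
  "('i, 'm) star_alg_scheme \<Rightarrow> ('j, 'n) star_alg_scheme \<Rightarrow> ('i \<times> 'j) star_alg" where
  "tensor_alg A B = \<lparr>
     mult_coeff = (\<lambda>(i, i') (j, j') (k, k'). mult_coeff A i j k * mult_coeff B i' j' k'),
     unit_coeff = tensor_vec (unit_coeff A) (unit_coeff B),
     star_coeff = (\<lambda>(i, i') (j, j'). star_coeff A i j * star_coeff B i' j') \<rparr>"

definition comult :: "('i::finite, 'm) hopf_star_alg_scheme \<Rightarrow> ('i \<Rightarrow> complex) \<Rightarrow> 'i \<times> 'i \<Rightarrow> complex" where
  "comult Q a = (\<lambda>(j, k). \<Sum>i\<in>UNIV. a i * comult_coeff Q i j k)"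

definition counit :: "('i::finite, 'm) hopf_star_alg_scheme \<Rightarrow> ('i \<Rightarrow> complex) \<Rightarrow> complex" where
  "counit Q a = (\<Sum>i\<in>UNIV. a i * counit_coeff Q i)"

definition antipode :: "('i::finite, 'm) hopf_star_alg_scheme \<Rightarrow> ('i \<Rightarrow> complex) \<Rightarrow> 'i \<Rightarrow> complex" where
  "antipode Q a = (\<lambda>j. \<Sum>i\<in>UNIV. a i * antipode_coeff Q i j)"

text \<open>
  \<open>\<Delta> \<otimes> id\<close> and \<open>id \<otimes> \<Delta>\<close>, both with values in \<open>Q \<otimes> (Q \<otimes> Q)\<close>, and the embeddings
  \<open>\<Omega> \<mapsto> \<Omega> \<otimes> 1\<close> and \<open>\<Omega> \<mapsto> 1 \<otimes> \<Omega>\<close> into the same algebra.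
\<close>

definition comult_id :: "('i::finite, 'm) hopf_star_alg_scheme \<Rightarrow> ('i \<times> 'i \<Rightarrow> complex) \<Rightarrow> 'i \<times> 'i \<times> 'i \<Rightarrow> complex" where
  "comult_id Q w = (\<lambda>(i, j, k). \<Sum>l\<in>UNIV. w (l, k) * comult_coeff Q l i j)"

definition id_comult :: "('i::finite, 'm) hopf_star_alg_scheme \<Rightarrow> ('i \<times> 'i \<Rightarrow> complex) \<Rightarrow> 'i \<times> 'i \<times> 'i \<Rightarrow> complex" where
  "id_comult Q w = (\<lambda>(i, j, k). \<Sum>l\<in>UNIV. w (i, l) * comult_coeff Q l j k)"

definition tensor_unit_right :: "('i, 'm) star_alg_scheme \<Rightarrow> ('i \<times> 'i \<Rightarrow> complex) \<Rightarrow> 'i \<times> 'i \<times> 'i \<Rightarrow> complex" where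
  "tensor_unit_right A w = (\<lambda>(i, j, k). w (i, j) * unit_coeff A k)"

definition tensor_unit_left :: "('i, 'm) star_alg_scheme \<Rightarrow> ('i \<times> 'i \<Rightarrow> complex) \<Rightarrow> 'i \<times> 'i \<times> 'i \<Rightarrow> complex" where
  "tensor_unit_left A w = (\<lambda>(i, j, k). unit_coeff A i * w (j, k))"

text \<open>
  The axioms of a Hopf star-algebra. Every map involved is linear or antilinear in each argument, so
  the identities are stated on basis vectors.
\<close>

definition star_algebra :: "('i::finite, 'm) star_alg_scheme \<Rightarrow> bool" where
  "star_algebra A \<longleftrightarrow> (\<forall>i j k.
     let a = basis_vec i; b = basis_vec j; c = basis_vec k in
     alg_mult A (alg_mult A a b) c = alg_mult A a (alg_mult A b c) \<and>
     alg_mult A (unit_coeff A) a = a \<and> alg_mult A a (unit_coeff A) = a \<and>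
     alg_star A (alg_star A a) = a \<and>
     alg_star A (alg_mult A a b) = alg_mult A (alg_star A b) (alg_star A a))"

definition hopf_star_algebra :: "('i::finite, 'm) hopf_star_alg_scheme \<Rightarrow> bool" where
  "hopf_star_algebra Q \<longleftrightarrow>
     star_algebra Q \<and>
     comult Q (unit_coeff Q) = tensor_vec (unit_coeff Q) (unit_coeff Q) \<and>
     counit Q (unit_coeff Q) = 1 \<and>
     (\<forall>i j. let a = basis_vec i; b = basis_vec j in
        comult Q (alg_mult Q a b) = alg_mult (tensor_alg Q Q) (comult Q a) (comult Q b) \<and>
        counit Q (alg_mult Q a b) = counit Q a * counit Q b \<and>
        comult Q (alg_star Q a) = alg_star (tensor_alg Q Q) (comult Q a) \<and>
        comult_id Q (comult Q a) = id_comult Q (comult Q a) \<and>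
        (\<lambda>k. \<Sum>l\<in>UNIV. counit_coeff Q l * comult Q a (l, k)) = a \<and>
        (\<lambda>k. \<Sum>l\<in>UNIV. comult Q a (k, l) * counit_coeff Q l) = a \<and>
        (\<lambda>k. \<Sum>l\<in>UNIV. \<Sum>m\<in>UNIV.
           comult Q a (l, m) * alg_mult Q (antipode Q (basis_vec l)) (basis_vec m) k) =
        (\<lambda>k. counit Q a * unit_coeff Q k) \<and>
        (\<lambda>k. \<Sum>l\<in>UNIV. \<Sum>m\<in>UNIV.
           comult Q a (l, m) * alg_mult Q (basis_vec l) (antipode Q (basis_vec m)) k) =
        (\<lambda>k. counit Q a * unit_coeff Q k))"

lemma sum_delta_left: "(\<Sum>i\<in>UNIV. basis_vec k i * f i) = f k" for f :: "'i::finite \<Rightarrow> complex"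
proof -
  have "(\<Sum>i\<in>UNIV. basis_vec k i * f i) = (\<Sum>i\<in>UNIV. if i = k then f i else 0)"
    by (rule sum.cong) (simp_all add: basis_vec_def)
  then show ?thesis by simp
qed

lemma alg_mult_basis_left: "alg_mult A (basis_vec i) b = (\<lambda>k. \<Sum>j\<in>UNIV. b j * mult_coeff A i j k)"
  by (simp add: alg_mult_def mult.assoc sum_distrib_left[symmetric] sum_delta_left)

lemma alg_mult_basis_right: "alg_mult A a (basis_vec j) = (\<lambda>k. \<Sum>i\<in>UNIV. a i * mult_coeff A i j k)"
  by (simp add: alg_mult_def mult.assoc sum_distrib_left[symmetric] sum_delta_left)

lemma alg_mult_basis: "alg_mult A (basis_vec i) (basis_vec j) = mult_coeff A i j"
  by (simp add: alg_mult_basis_left sum_delta_left)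

lemma cnj_basis_vec: "cnj (basis_vec i j) = basis_vec i j"
  by (simp add: basis_vec_def)

lemma alg_star_basis: "alg_star A (basis_vec i) = star_coeff A i"
  by (simp add: alg_star_def cnj_basis_vec sum_delta_left)

lemma comult_basis: "comult Q (basis_vec i) = (\<lambda>(j, k). comult_coeff Q i j k)"
  by (simp add: comult_def sum_delta_left)

lemma counit_basis: "counit Q (basis_vec i) = counit_coeff Q i"
  by (simp add: counit_def sum_delta_left)

lemma antipode_basis: "antipode Q (basis_vec i) = antipode_coeff Q i"
  by (simp add: antipode_def sum_delta_left)

lemma tensor_vec_basis: "tensor_vec (basis_vec i) (basis_vec j) = basis_vec (i, j)"
  by (auto simp: tensor_vec_def basis_vec_def)

lemma sum_prod: "(\<Sum>m\<in>UNIV. f m) = (\<Sum>u\<in>UNIV. \<Sum>v\<in>UNIV. f (u, v))"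
  for f :: "'a::finite \<times> 'b::finite \<Rightarrow> complex"
  by (simp add: sum.cartesian_product)


section \<open>The dual Hopf star-algebra\<close>

text \<open>
  A linear functional \<open>\<phi>\<close> is identified with its values \<open>\<phi>(e\<^sub>i)\<close>, that is, with its coordinates with
  respect to the dual basis.
\<close>

definition pairing :: "('i::finite \<Rightarrow> complex) \<Rightarrow> ('i \<Rightarrow> complex) \<Rightarrow> complex" where
  "pairing \<phi> a = (\<Sum>i\<in>UNIV. \<phi> i * a i)"

definition dual_hopf :: "('i::finite, 'm) hopf_star_alg_scheme \<Rightarrow> 'i hopf_star_alg" where
  "dual_hopf Q = \<lparr>
     mult_coeff = (\<lambda>i j k. comult_coeff Q k i j),
     unit_coeff = counit_coeff Q,
     star_coeff = (\<lambda>i j. cnj (alg_star Q (antipode Q (basis_vec j)) i)),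
     comult_coeff = (\<lambda>i j k. mult_coeff Q j k i),
     counit_coeff = unit_coeff Q,
     antipode_coeff = (\<lambda>i j. antipode_coeff Q j i) \<rparr>"

lemma pairing_dual_mult:
  "pairing (alg_mult (dual_hopf Q) \<phi> \<psi>) a = pairing (tensor_vec \<phi> \<psi>) (comult Q a)"
proof -
  have "pairing (alg_mult (dual_hopf Q) \<phi> \<psi>) a =
      (\<Sum>k\<in>UNIV. \<Sum>i\<in>UNIV. \<Sum>j\<in>UNIV. \<phi> i * \<psi> j * (a k * comult_coeff Q k i j))"
    by (simp add: pairing_def alg_mult_def dual_hopf_def sum_distrib_left sum_distrib_right mult_ac)
  also have "\<dots> = (\<Sum>i\<in>UNIV. \<Sum>k\<in>UNIV. \<Sum>j\<in>UNIV. \<phi> i * \<psi> j * (a k * comult_coeff Q k i j))"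
    by (rule sum.swap)
  also have "\<dots> = (\<Sum>i\<in>UNIV. \<Sum>j\<in>UNIV. \<Sum>k\<in>UNIV. \<phi> i * \<psi> j * (a k * comult_coeff Q k i j))"
    by (intro sum.cong refl sum.swap)
  finally show ?thesis
    by (simp add: pairing_def tensor_vec_def comult_def sum_prod sum_distrib_left)
qed

lemma pairing_dual_unit: "pairing (unit_coeff (dual_hopf Q)) a = counit Q a"
  by (simp add: pairing_def dual_hopf_def counit_def mult.commute)

lemma pairing_dual_comult:
  "pairing (comult (dual_hopf Q) \<phi>) (tensor_vec a b) = pairing \<phi> (alg_mult Q a b)"
proof -
  have "pairing \<phi> (alg_mult Q a b) =
      (\<Sum>k\<in>UNIV. \<Sum>i\<in>UNIV. \<Sum>j\<in>UNIV. \<phi> k * mult_coeff Q i j k * (a i * b j))"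
    by (simp add: pairing_def alg_mult_def sum_distrib_left mult_ac)
  also have "\<dots> = (\<Sum>i\<in>UNIV. \<Sum>k\<in>UNIV. \<Sum>j\<in>UNIV. \<phi> k * mult_coeff Q i j k * (a i * b j))"
    by (rule sum.swap)
  also have "\<dots> = (\<Sum>i\<in>UNIV. \<Sum>j\<in>UNIV. \<Sum>k\<in>UNIV. \<phi> k * mult_coeff Q i j k * (a i * b j))"
    by (intro sum.cong refl sum.swap)
  finally show ?thesis
    by (simp add: pairing_def tensor_vec_def comult_def dual_hopf_def sum_prod sum_distrib_right)
qed

lemma pairing_dual_counit: "counit (dual_hopf Q) \<phi> = pairing \<phi> (unit_coeff Q)"
  by (simp add: pairing_def dual_hopf_def counit_def)

lemma pairing_dual_antipode:
  "pairing (antipode (dual_hopf Q) \<phi>) a = pairing \<phi> (antipode Q a)"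
proof -
  have "pairing (antipode (dual_hopf Q) \<phi>) a =
      (\<Sum>j\<in>UNIV. \<Sum>i\<in>UNIV. \<phi> i * (a j * antipode_coeff Q j i))"
    by (simp add: pairing_def antipode_def dual_hopf_def sum_distrib_left sum_distrib_right mult_ac)
  also have "\<dots> = (\<Sum>i\<in>UNIV. \<Sum>j\<in>UNIV. \<phi> i * (a j * antipode_coeff Q j i))"
    by (rule sum.swap)
  finally show ?thesis
    by (simp add: pairing_def antipode_def sum_distrib_left)
qed

lemma pairing_dual_star:
  "pairing (alg_star (dual_hopf Q) \<phi>) a = cnj (pairing \<phi> (alg_star Q (antipode Q a)))"
proof -
  have "cnj (pairing \<phi> (alg_star Q (antipode Q a))) =
      (\<Sum>i\<in>UNIV. \<Sum>k\<in>UNIV. \<Sum>j\<in>UNIV. cnj (\<phi> i) * a j * antipode_coeff Q j k * cnj (star_coeff Q k i))"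
    by (simp add: pairing_def alg_star_def antipode_def sum_distrib_left sum_distrib_right mult_ac)
  also have "\<dots> = (\<Sum>i\<in>UNIV. \<Sum>j\<in>UNIV. \<Sum>k\<in>UNIV. cnj (\<phi> i) * a j * antipode_coeff Q j k * cnj (star_coeff Q k i))"
    by (intro sum.cong refl sum.swap)
  also have "\<dots> = (\<Sum>j\<in>UNIV. \<Sum>i\<in>UNIV. \<Sum>k\<in>UNIV. cnj (\<phi> i) * a j * antipode_coeff Q j k * cnj (star_coeff Q k i))"
    by (rule sum.swap)
  finally show ?thesis
    unfolding pairing_def alg_star_def[of "dual_hopf Q"] dual_hopf_def antipode_basis
    by (simp add: alg_star_def sum_distrib_left sum_distrib_right mult_ac)
qed


section \<open>Invariant 2-cocycles and the cohomology groups\<close>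

definition mult_monoid :: "('i::finite, 'm) star_alg_scheme \<Rightarrow> ('i \<Rightarrow> complex) monoid" where
  "mult_monoid A = \<lparr>carrier = UNIV, mult = alg_mult A, one = unit_coeff A\<rparr>"

definition central :: "('i::finite, 'm) star_alg_scheme \<Rightarrow> ('i \<Rightarrow> complex) \<Rightarrow> bool" where
  "central A v \<longleftrightarrow> (\<forall>a. alg_mult A v a = alg_mult A a v)"

definition unitary :: "('i::finite, 'm) star_alg_scheme \<Rightarrow> ('i \<Rightarrow> complex) \<Rightarrow> bool" where
  "unitary A v \<longleftrightarrow> alg_mult A (alg_star A v) v = unit_coeff A \<and> alg_mult A v (alg_star A v) = unit_coeff A"

definition two_cocycle :: "('i::finite, 'm) hopf_star_alg_scheme \<Rightarrow> ('i \<times> 'i \<Rightarrow> complex) \<Rightarrow> bool" where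
  "two_cocycle Q w \<longleftrightarrow>
     w \<in> Units (mult_monoid (tensor_alg Q Q)) \<and>
     alg_mult (tensor_alg Q (tensor_alg Q Q)) (tensor_unit_left Q w) (id_comult Q w) =
     alg_mult (tensor_alg Q (tensor_alg Q Q)) (tensor_unit_right Q w) (comult_id Q w)"

definition invariant :: "('i::finite, 'm) hopf_star_alg_scheme \<Rightarrow> ('i \<times> 'i \<Rightarrow> complex) \<Rightarrow> bool" where
  "invariant Q w \<longleftrightarrow>
     (\<forall>a. alg_mult (tensor_alg Q Q) w (comult Q a) = alg_mult (tensor_alg Q Q) (comult Q a) w)"

definition A1 :: "('i::finite, 'm) hopf_star_alg_scheme \<Rightarrow> ('i \<Rightarrow> complex) monoid" where
  "A1 Q = (mult_monoid Q)\<lparr>carrier := {v \<in> Units (mult_monoid Q). central Q v}\<rparr>"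

definition A1_u :: "('i::finite, 'm) hopf_star_alg_scheme \<Rightarrow> ('i \<Rightarrow> complex) monoid" where
  "A1_u Q = (mult_monoid Q)\<lparr>carrier := {v. central Q v \<and> unitary Q v}\<rparr>"

definition A2 :: "('i::finite, 'm) hopf_star_alg_scheme \<Rightarrow> ('i \<times> 'i \<Rightarrow> complex) monoid" where
  "A2 Q = (mult_monoid (tensor_alg Q Q))\<lparr>carrier := {w. two_cocycle Q w \<and> invariant Q w}\<rparr>"

definition A2_u :: "('i::finite, 'm) hopf_star_alg_scheme \<Rightarrow> ('i \<times> 'i \<Rightarrow> complex) monoid" where
  "A2_u Q = (mult_monoid (tensor_alg Q Q))
     \<lparr>carrier := {w. two_cocycle Q w \<and> invariant Q w \<and> unitary (tensor_alg Q Q) w}\<rparr>"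

definition coboundary :: "('i::finite, 'm) hopf_star_alg_scheme \<Rightarrow> ('i \<Rightarrow> complex) \<Rightarrow> 'i \<times> 'i \<Rightarrow> complex" where
  "coboundary Q v =
     alg_mult (tensor_alg Q Q) (tensor_vec v v) (comult Q (inv\<^bsub>mult_monoid Q\<^esub> v))"

definition H2_inv :: "('i::finite, 'm) hopf_star_alg_scheme \<Rightarrow> ('i \<times> 'i \<Rightarrow> complex) set monoid" where
  "H2_inv Q = A2 Q Mod (coboundary Q ` carrier (A1 Q))"

definition H2_uinv :: "('i::finite, 'm) hopf_star_alg_scheme \<Rightarrow> ('i \<times> 'i \<Rightarrow> complex) set monoid" where
  "H2_uinv Q = A2_u Q Mod (coboundary Q ` carrier (A1_u Q))"


section \<open>The Kac--Paljutkin algebra\<close>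

text \<open>
  The basis vector indexed by \<open>(i, j, k)\<close> is the monomial \<open>x\<^sup>i y\<^sup>j z\<^sup>k\<close>, an exponent being a truth value
  (\<open>False\<close> for 0, \<open>True\<close> for 1); addition of exponents modulo 2 is \<open>\<noteq>\<close>.
  By the relations, the monomials span the algebra, and the structure constants
  below are obtained by rewriting with \<open>z x\<^sup>p y\<^sup>q = x\<^sup>q y\<^sup>p z\<close> and
  \<open>z\<^sup>2 = \<Sum>\<^sub>s\<^sub>t kp_c s t x\<^sup>s y\<^sup>t\<close>; the same coefficients occur in
  \<open>z\<^sup>-\<^sup>1 = z\<^sup>2 z = \<Sum>\<^sub>s\<^sub>t kp_c s t x\<^sup>s y\<^sup>t z\<close> and in \<open>\<Delta>(z) = \<Sum>\<^sub>s\<^sub>t kp_c s t y\<^sup>s z \<otimes> x\<^sup>t z\<close>.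
\<close>

type_synonym kp_index = "bool \<times> bool \<times> bool"

definition kp_c :: "bool \<Rightarrow> bool \<Rightarrow> complex" where
  "kp_c s t = (if s \<and> t then - 1 / 2 else 1 / 2)"

fun kp_mult :: "kp_index \<Rightarrow> kp_index \<Rightarrow> kp_index \<Rightarrow> complex" where
  "kp_mult (i, j, k) (p, q, r) (u, v, w) =
     (let i' = (i \<noteq> (if k then q else p)); j' = (j \<noteq> (if k then p else q)) in
      if w \<noteq> (k \<noteq> r) then 0
      else if k \<and> r then kp_c (u \<noteq> i') (v \<noteq> j')
      else if u = i' \<and> v = j' then 1 else 0)"

fun kp_star :: "kp_index \<Rightarrow> kp_index \<Rightarrow> complex" where
  "kp_star (i, j, k) (u, v, w) =
     (if w \<noteq> k then 0
      else if k then kp_c (u \<noteq> j) (v \<noteq> i)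
      else if u = i \<and> v = j then 1 else 0)"

fun kp_comult :: "kp_index \<Rightarrow> kp_index \<Rightarrow> kp_index \<Rightarrow> complex" where
  "kp_comult (i, j, k) (p, q, r) (u, v, w) =
     (if r \<noteq> k \<or> w \<noteq> k \<or> p \<noteq> i \<or> v \<noteq> j then 0
      else if k then kp_c (q \<noteq> j) (u \<noteq> i)
      else if q = j \<and> u = i then 1 else 0)"

fun kp_antipode :: "kp_index \<Rightarrow> kp_index \<Rightarrow> complex" where
  "kp_antipode (i, j, k) l = (if l = (if k then (j, i, k) else (i, j, k)) then 1 else 0)"

definition kac_paljutkin :: "kp_index hopf_star_alg" where
  "kac_paljutkin = \<lparr>
     mult_coeff = kp_mult,
     unit_coeff = basis_vec (False, False, False),
     star_coeff = kp_star,
     comult_coeff = kp_comult,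
     counit_coeff = (\<lambda>_. 1),
     antipode_coeff = kp_antipode \<rparr>"

lemma sum_bool: "(\<Sum>b\<in>UNIV. f b) = f False + f True" for f :: "bool \<Rightarrow> complex"
  by (simp add: UNIV_bool)

lemma sum_kp: "(\<Sum>m\<in>UNIV. f m) = (\<Sum>u\<in>UNIV. \<Sum>v\<in>UNIV. \<Sum>w\<in>UNIV. f (u, v, w))" for f :: "kp_index \<Rightarrow> complex"
  by (simp add: sum_prod)

lemma kp_c_simps: "kp_c False t = 1/2" "kp_c s False = 1/2" "kp_c True True = -1/2" by (auto simp: kp_c_def)

lemma kp_mult_sum:
  "(\<Sum>m\<in>UNIV. kp_mult (i,j,k) (p,q,r) m * F m) =
   (let i' = (i \<noteq> (if k then q else p)); j' = (j \<noteq> (if k then p else q)) in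
    if k \<and> r then \<Sum>s\<in>UNIV. \<Sum>t\<in>UNIV. kp_c s t * F (s \<noteq> i', t \<noteq> j', False)
    else F (i', j', k \<noteq> r))"
  by (cases i; cases j; cases k; cases p; cases q; cases r; simp add: sum_kp sum_bool kp_c_simps)

lemma kp_comult_sum:
  "(\<Sum>a\<in>UNIV. \<Sum>b\<in>UNIV. kp_comult (i,j,k) a b * F a b) =
   (if k then \<Sum>s\<in>UNIV. \<Sum>t\<in>UNIV. kp_c s t * F (i, j \<noteq> s, True) (i \<noteq> t, j, True)
    else F (i,j,False) (i,j,False))"
  by (cases i; cases j; cases k; simp add: sum_kp sum_bool kp_c_simps)

lemma kp_star_sum:
  "(\<Sum>m\<in>UNIV. kp_star (i,j,k) m * F m) =
   (if k then \<Sum>s\<in>UNIV. \<Sum>t\<in>UNIV. kp_c s t * F (s \<noteq> j, t \<noteq> i, True) else F (i,j,False))"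
  by (cases i; cases j; cases k; simp add: sum_kp sum_bool kp_c_simps)

definition kp_x :: "kp_index \<Rightarrow> complex" where
  "kp_x = basis_vec (True, False, False)"

definition kp_y :: "kp_index \<Rightarrow> complex" where
  "kp_y = basis_vec (False, True, False)"

definition kp_z :: "kp_index \<Rightarrow> complex" where
  "kp_z = basis_vec (False, False, True)"

lemma kp_monomial:
  "basis_vec (i, j, k) =
     alg_mult kac_paljutkin
       (alg_mult kac_paljutkin (if i then kp_x else unit_coeff kac_paljutkin)
          (if j then kp_y else unit_coeff kac_paljutkin))
       (if k then kp_z else unit_coeff kac_paljutkin)"
proof -
  have "alg_mult kac_paljutkin (basis_vec (i, False, False)) (basis_vec (False, j, False)) =
      basis_vec (i, j, False)"
    unfolding alg_mult_basis by (auto simp: kac_paljutkin_def basis_vec_def fun_eq_iff)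
  moreover have "alg_mult kac_paljutkin (basis_vec (i, j, False)) (basis_vec (False, False, k)) =
      basis_vec (i, j, k)"
    unfolding alg_mult_basis by (auto simp: kac_paljutkin_def basis_vec_def fun_eq_iff)
  moreover have "(if i then kp_x else unit_coeff kac_paljutkin) = basis_vec (i, False, False)"
    "(if j then kp_y else unit_coeff kac_paljutkin) = basis_vec (False, j, False)"
    "(if k then kp_z else unit_coeff kac_paljutkin) = basis_vec (False, False, k)"
    by (simp_all add: kp_x_def kp_y_def kp_z_def kac_paljutkin_def)
  ultimately show ?thesis by simp
qed

lemma kp_relations:
  shows "alg_mult kac_paljutkin kp_x kp_x = unit_coeff kac_paljutkin"
    and "alg_mult kac_paljutkin kp_y kp_y = unit_coeff kac_paljutkin"
    and "alg_mult kac_paljutkin kp_x kp_y = alg_mult kac_paljutkin kp_y kp_x"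
    and "alg_mult kac_paljutkin kp_z kp_x = alg_mult kac_paljutkin kp_y kp_z"
    and "alg_mult kac_paljutkin kp_z kp_y = alg_mult kac_paljutkin kp_x kp_z"
    and "alg_mult kac_paljutkin kp_z kp_z =
      (\<lambda>l. (unit_coeff kac_paljutkin l + kp_x l + kp_y l - alg_mult kac_paljutkin kp_x kp_y l) / 2)"
  unfolding kp_x_def kp_y_def kp_z_def alg_mult_basis
  by (auto simp: kac_paljutkin_def basis_vec_def kp_c_def fun_eq_iff)

lemma kp_comult_generators:
  shows "comult kac_paljutkin kp_x = tensor_vec kp_x kp_x"
    and "comult kac_paljutkin kp_y = tensor_vec kp_y kp_y"
    and "comult kac_paljutkin kp_z =
      alg_mult (tensor_alg kac_paljutkin kac_paljutkin)
        (\<lambda>l. (tensor_vec (unit_coeff kac_paljutkin) (unit_coeff kac_paljutkin) l +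
               tensor_vec (unit_coeff kac_paljutkin) kp_x l +
               tensor_vec kp_y (unit_coeff kac_paljutkin) l -
               tensor_vec kp_y kp_x l) / 2)
        (tensor_vec kp_z kp_z)"
proof -
  show "comult kac_paljutkin kp_x = tensor_vec kp_x kp_x" "comult kac_paljutkin kp_y = tensor_vec kp_y kp_y"
    unfolding kp_x_def kp_y_def comult_basis tensor_vec_basis
    by (auto simp: kac_paljutkin_def basis_vec_def fun_eq_iff)
  have half: "alg_mult A (\<lambda>l. (basis_vec i l + basis_vec j l + basis_vec k l - basis_vec m l) / 2) (basis_vec n) =
      (\<lambda>l. (mult_coeff A i n l + mult_coeff A j n l + mult_coeff A k n l - mult_coeff A m n l) / 2)"
    for A :: "(kp_index \<times> kp_index) star_alg" and i j k m n
  proof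
    fix l
    have "alg_mult A (\<lambda>l. (basis_vec i l + basis_vec j l + basis_vec k l - basis_vec m l) / 2) (basis_vec n) l =
        (\<Sum>p\<in>UNIV. basis_vec i p * (mult_coeff A p n l / 2) + basis_vec j p * (mult_coeff A p n l / 2) +
          basis_vec k p * (mult_coeff A p n l / 2) - basis_vec m p * (mult_coeff A p n l / 2))"
      unfolding alg_mult_basis_right by (intro sum.cong refl) (simp add: field_simps)
    then show "alg_mult A (\<lambda>l. (basis_vec i l + basis_vec j l + basis_vec k l - basis_vec m l) / 2) (basis_vec n) l =
        (mult_coeff A i n l + mult_coeff A j n l + mult_coeff A k n l - mult_coeff A m n l) / 2"
      by (simp only: sum.distrib sum_subtractf sum_delta_left add_divide_distrib diff_divide_distrib)
  qed
  have u: "unit_coeff kac_paljutkin = basis_vec (False, False, False)"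
    by (simp add: kac_paljutkin_def)
  show "comult kac_paljutkin kp_z =
      alg_mult (tensor_alg kac_paljutkin kac_paljutkin)
        (\<lambda>l. (tensor_vec (unit_coeff kac_paljutkin) (unit_coeff kac_paljutkin) l +
               tensor_vec (unit_coeff kac_paljutkin) kp_x l +
               tensor_vec kp_y (unit_coeff kac_paljutkin) l -
               tensor_vec kp_y kp_x l) / 2)
        (tensor_vec kp_z kp_z)"
    unfolding u kp_x_def kp_y_def kp_z_def tensor_vec_basis half comult_basis
    by (auto simp: tensor_alg_def kac_paljutkin_def kp_c_def fun_eq_iff)
qed

lemma kp_star_generators:
  shows "alg_star kac_paljutkin kp_x = kp_x"
    and "alg_star kac_paljutkin kp_y = kp_y"
    and "alg_mult kac_paljutkin (alg_star kac_paljutkin kp_z) kp_z = unit_coeff kac_paljutkin"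
    and "alg_mult kac_paljutkin kp_z (alg_star kac_paljutkin kp_z) = unit_coeff kac_paljutkin"
proof -
  show "alg_star kac_paljutkin kp_x = kp_x" "alg_star kac_paljutkin kp_y = kp_y"
    unfolding kp_x_def kp_y_def alg_star_basis
    by (auto simp: kac_paljutkin_def basis_vec_def fun_eq_iff)
  show "alg_mult kac_paljutkin (alg_star kac_paljutkin kp_z) kp_z = unit_coeff kac_paljutkin"
    "alg_mult kac_paljutkin kp_z (alg_star kac_paljutkin kp_z) = unit_coeff kac_paljutkin"
    unfolding kp_z_def alg_star_basis alg_mult_basis_left alg_mult_basis_right
    by (auto simp: kac_paljutkin_def kp_star_sum sum_bool basis_vec_def kp_c_def fun_eq_iff)
qed

lemma kp_c_core: "(\<Sum>s\<in>UNIV. \<Sum>t\<in>UNIV. kp_c s t * (\<Sum>s'\<in>UNIV. \<Sum>t'\<in>UNIV. kp_c s' t' * (kp_c (s' \<noteq> a) (s \<noteq> b) * kp_c (t \<noteq> c) (t' \<noteq> d))))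
  = (if c = a \<and> d = b then kp_c a b else 0)"
  by (cases a; cases b; cases c; cases d; simp add: sum_bool kp_c_simps)

lemma kp_c_conv:
  "(\<Sum>s\<in>UNIV. \<Sum>t\<in>UNIV. kp_c s t * (if u = (s \<noteq> a) \<and> v = (t \<noteq> b) then 1 else 0)) = kp_c (u \<noteq> a) (v \<noteq> b)"
  "(\<Sum>s\<in>UNIV. \<Sum>t\<in>UNIV. kp_c s t * (if u = (i \<noteq> (s \<noteq> a)) \<and> v = (j \<noteq> (t \<noteq> b)) then 1 else 0)) = kp_c (u \<noteq> (i \<noteq> a)) (v \<noteq> (j \<noteq> b))"
  "(\<Sum>s\<in>UNIV. \<Sum>t\<in>UNIV. kp_c s t * (if u = (i \<noteq> (t \<noteq> a)) \<and> v = (j \<noteq> (s \<noteq> b)) then 1 else 0)) = kp_c (u \<noteq> (i \<noteq> a)) (v \<noteq> (j \<noteq> b))"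
  by (cases a; cases b; cases u; cases v; (cases i; cases j)?; simp add: sum_bool kp_c_simps)+

lemma xor_assoc: "((a \<noteq> b) \<noteq> c) = (a \<noteq> (b \<noteq> c))" for a b c :: bool
  by auto

lemma xor_eval:
  "(True \<noteq> True) = False" "(True \<noteq> False) = True" "(False \<noteq> True) = True" "(False \<noteq> False) = False"
  "(True \<and> b) = b" "(False \<and> b) = False" for b
  by auto

lemma kp_mult_assoc:
  "(\<Sum>m\<in>UNIV. kp_mult i j m * kp_mult m k l) = (\<Sum>m\<in>UNIV. kp_mult j k m * kp_mult i m l)"
proof -
  obtain i1 i2 i3 j1 j2 j3 k1 k2 k3 l1 l2 l3 where
    ijkl: "i = (i1,i2,i3)" "j = (j1,j2,j3)" "k = (k1,k2,k3)" "l = (l1,l2,l3)"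
    by (metis prod_cases3)
  show ?thesis
    unfolding ijkl kp_mult_sum kp_mult.simps Let_def
    by (cases i3; cases j3; cases k3; cases l3; 
        simp only: if_True if_False xor_eval xor_assoc kp_c_conv mult_zero_right sum.neutral_const)
qed


lemma kp_comult_conv:
  "(\<Sum>s\<in>UNIV. \<Sum>t\<in>UNIV. kp_c s t * kp_comult (s \<noteq> a, t \<noteq> b, False) (p1, p2, False) (q1, q2, False)) =
   (if q1 = p1 \<and> q2 = p2 then kp_c (p1 \<noteq> a) (p2 \<noteq> b) else 0)"
  by (cases a; cases b; cases p1; cases p2; cases q1; cases q2; simp add: sum_bool kp_c_simps)

lemma kp_c_conv_pair:
  "(\<Sum>s\<in>UNIV. \<Sum>t\<in>UNIV. kp_c s t *
      ((if P \<and> p = (s \<noteq> a) then 1 else 0) * (if q = (t \<noteq> b) \<and> Q then 1 else 0))) =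
   (if P \<and> Q then kp_c (p \<noteq> a) (q \<noteq> b) else 0)"
  by (cases P; cases Q; cases a; cases b; cases p; cases q; simp add: sum_bool kp_c_simps)

lemma kp_bialg:
  "(\<Sum>m\<in>UNIV. kp_mult i j m * kp_comult m p q) =
   (\<Sum>a\<in>UNIV. \<Sum>b\<in>UNIV. kp_comult i a b *
     (\<Sum>c\<in>UNIV. \<Sum>d\<in>UNIV. kp_comult j c d * (kp_mult a c p * kp_mult b d q)))"
proof -
  obtain i1 i2 i3 j1 j2 j3 p1 p2 p3 q1 q2 q3 where
    ijpq: "i = (i1, i2, i3)" "j = (j1, j2, j3)" "p = (p1, p2, p3)" "q = (q1, q2, q3)"
    by (metis prod_cases3)
  have core: "(p1 \<noteq> (i1 \<noteq> (j2 \<noteq> s'))) = (s' \<noteq> (p1 \<noteq> (i1 \<noteq> j2)))"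
    "(p2 \<noteq> ((i2 \<noteq> s) \<noteq> j1)) = (s \<noteq> (p2 \<noteq> (i2 \<noteq> j1)))"
    "(q1 \<noteq> ((i1 \<noteq> t) \<noteq> j2)) = (t \<noteq> (q1 \<noteq> (i1 \<noteq> j2)))"
    "(q2 \<noteq> (i2 \<noteq> (j1 \<noteq> t'))) = (t' \<noteq> (q2 \<noteq> (i2 \<noteq> j1)))"
    "((q1 \<noteq> a) = (p1 \<noteq> a)) = (q1 = p1)" "((q2 \<noteq> a) = (p2 \<noteq> a)) = (q2 = p2)" for s s' t t' a
    by auto
  have pair: "(p2 = ((i2 \<noteq> s) \<noteq> j1)) = (p2 = (s \<noteq> (i2 \<noteq> j1)))"
    "(p2 = (i2 \<noteq> (j2 \<noteq> s))) = (p2 = (s \<noteq> (i2 \<noteq> j2)))"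
    "(q1 = ((i1 \<noteq> t) \<noteq> j2)) = (q1 = (t \<noteq> (i1 \<noteq> j2)))"
    "(q1 = (i1 \<noteq> (j1 \<noteq> t))) = (q1 = (t \<noteq> (i1 \<noteq> j1)))" for s t
    by auto
  show ?thesis
  proof (cases "p3 = (i3 \<noteq> j3) \<and> q3 = (i3 \<noteq> j3)")
    case False
    then show ?thesis
      unfolding ijpq kp_mult_sum kp_comult_sum kp_mult.simps Let_def
      by (cases i3; cases j3; cases p3; cases q3;
          simp only: if_True if_False simp_thms mult_zero_right mult_zero_left sum.neutral_const kp_comult.simps)
  next
    case True
    show ?thesis
      unfolding ijpq kp_mult_sum kp_comult_sum kp_mult.simps Let_def conjunct1[OF True] conjunct2[OF True]
      by (cases "i3 \<and> j3"; cases i3; cases j3;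
          (simp only: if_True if_False xor_eval core kp_c_core kp_comult_conv; fail)?;
          simp only: if_True if_False xor_eval pair kp_c_conv_pair; auto)
  qed
qed

lemma kp_comult_nonzero:
  "kp_comult (i1, i2, i3) (p1, p2, p3) (q1, q2, q3) \<noteq> 0 \<Longrightarrow> p1 = i1 \<and> q2 = i2 \<and> p3 = i3 \<and> q3 = i3"
  by (auto split: if_splits)

lemma kp_comult_coassoc:
  "(\<Sum>m\<in>UNIV. kp_comult i m l * kp_comult m j k) = (\<Sum>m\<in>UNIV. kp_comult i j m * kp_comult m k l)"
proof -
  obtain i1 i2 i3 j1 j2 j3 k1 k2 k3 l1 l2 l3 where
    ijkl: "i = (i1, i2, i3)" "j = (j1, j2, j3)" "k = (k1, k2, k3)" "l = (l1, l2, l3)"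
    by (metis prod_cases3)
  have L: "kp_comult i m l * kp_comult m j k \<noteq> 0 \<Longrightarrow>
      m = (i1, k2, i3) \<and> j1 = i1 \<and> l2 = i2 \<and> j3 = i3 \<and> k3 = i3 \<and> l3 = i3" for m
    unfolding ijkl by (cases m) (auto simp del: kp_comult.simps dest!: kp_comult_nonzero)
  have R: "kp_comult i j m * kp_comult m k l \<noteq> 0 \<Longrightarrow>
      m = (k1, i2, i3) \<and> j1 = i1 \<and> l2 = i2 \<and> j3 = i3 \<and> k3 = i3 \<and> l3 = i3" for m
    unfolding ijkl by (cases m) (auto simp del: kp_comult.simps dest!: kp_comult_nonzero)
  have "(\<Sum>m\<in>UNIV. kp_comult i m l * kp_comult m j k) =
      (\<Sum>m\<in>UNIV. if m = (i1, k2, i3) then kp_comult i m l * kp_comult m j k else 0)"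
    using L by (intro sum.cong refl) metis
  moreover have "(\<Sum>m\<in>UNIV. kp_comult i j m * kp_comult m k l) =
      (\<Sum>m\<in>UNIV. if m = (k1, i2, i3) then kp_comult i j m * kp_comult m k l else 0)"
    using R by (intro sum.cong refl) metis
  moreover have "kp_comult i (i1, k2, i3) l * kp_comult (i1, k2, i3) j k =
      kp_comult i j (k1, i2, i3) * kp_comult (k1, i2, i3) k l"
  proof (cases "j1 = i1 \<and> l2 = i2 \<and> j3 = i3 \<and> k3 = i3 \<and> l3 = i3")
    case False
    then show ?thesis using L R by metis
  next
    case True
    then show ?thesis
      unfolding ijkl
      by (cases i3; cases i1; cases i2; cases j2; cases k1; cases k2; cases l1; simp add: kp_c_simps)
  qed
  ultimately show ?thesis by simp
qed

lemma kp_star_mult: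
  "(\<Sum>m\<in>UNIV. kp_mult i j m * kp_star m l) = (\<Sum>p\<in>UNIV. kp_star j p * (\<Sum>q\<in>UNIV. kp_star i q * kp_mult p q l))"
proof -
  obtain i1 i2 i3 j1 j2 j3 l1 l2 l3 where
    ijkl: "i = (i1,i2,i3)" "j = (j1,j2,j3)"  "l = (l1,l2,l3)"
    by (metis prod_cases3)
  show ?thesis
  proof (cases "l3 = (i3 \<noteq> j3)")
    case False
    then show ?thesis 
      unfolding ijkl kp_mult_sum kp_star_sum kp_mult.simps Let_def
      by (cases i3; cases j3; 
        simp only: if_True if_False simp_thms mult_zero_right mult_zero_left sum.neutral_const kp_star.simps)
  next
    case True
    then show ?thesis 
    unfolding ijkl kp_mult_sum kp_star_sum
    by (cases i3; cases j3; cases i1; cases i2; cases j1; cases j2; cases l1; cases l2; simp add: kp_c_simps sum_bool)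
  qed
qed

lemma kp_star_comult:
  "(\<Sum>m\<in>UNIV. kp_star i m * kp_comult m p q) = (\<Sum>a\<in>UNIV. \<Sum>b\<in>UNIV. kp_comult i a b * (kp_star a p * kp_star b q))"
proof -
  obtain i1 i2 i3 p1 p2 p3 q1 q2 q3 where
    ijkl: "i = (i1,i2,i3)" "p = (p1,p2,p3)" "q = (q1,q2,q3)"
    by (metis prod_cases3)
  show ?thesis
  proof (cases "p3 = i3 \<and> q3 = i3")
    case False
    then show ?thesis 
      unfolding ijkl kp_comult_sum kp_star_sum 
      by (cases i3; auto)
  next
    case True
    then show ?thesis 
    unfolding ijkl kp_comult_sum kp_star_sum
    by (cases i3; cases i1; cases i2; cases p1; cases p2; cases q1; cases q2; simp add: kp_c_simps sum_bool)
  qed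
qed

lemma cnj_kp_c: "cnj (kp_c s t) = kp_c s t"
  by (simp add: kp_c_def)

lemma cnj_kp: "cnj (kp_mult i j k) = kp_mult i j k" "cnj (kp_comult i j k) = kp_comult i j k"
  "cnj (kp_star i j) = kp_star i j" "cnj (kp_antipode i j) = kp_antipode i j"
  by (cases i; cases j; cases k; simp add: cnj_kp_c if_distrib[where f=cnj] Let_def cong: if_cong)+

lemma kp_unit: "kp_mult (False, False, False) i = basis_vec i" "(\<lambda>k. kp_mult i (False, False, False) k) = basis_vec i"
  by (cases i; auto simp: basis_vec_def Let_def fun_eq_iff)+

lemma kp_star_star: "(\<Sum>m\<in>UNIV. kp_star i m * kp_star m l) = basis_vec i l"
proof -
  obtain i1 i2 i3 l1 l2 l3 where
    ijkl: "i = (i1,i2,i3)" "l = (l1,l2,l3)"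
    by (metis prod_cases3)
  show ?thesis
    unfolding ijkl kp_star_sum
    by (cases i3; cases l3; cases i1; cases i2; cases l1; cases l2; simp add: kp_c_simps sum_bool basis_vec_def)
qed

lemma kp_counit: "(\<Sum>l\<in>UNIV. kp_comult i l k) = basis_vec i k" "(\<Sum>l\<in>UNIV. kp_comult i k l) = basis_vec i k"
  "(\<Sum>l\<in>UNIV. kp_mult i j l) = 1"
proof -
  obtain i1 i2 i3 j1 j2 j3 k1 k2 k3 where
    ijkl: "i = (i1,i2,i3)" "k = (k1,k2,k3)" "j = (j1,j2,j3)"
    by (metis prod_cases3)
  show "(\<Sum>l\<in>UNIV. kp_comult i l k) = basis_vec i k" "(\<Sum>l\<in>UNIV. kp_comult i k l) = basis_vec i k"
    unfolding ijkl sum_kp sum_bool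
    by (cases i3; cases k3; cases i1; cases i2; cases k1; cases k2; simp add: kp_c_simps basis_vec_def)+
  show "(\<Sum>l\<in>UNIV. kp_mult i j l) = 1"
    using kp_mult_sum[of i1 i2 i3 j1 j2 j3 "\<lambda>_. 1"]
    unfolding ijkl by (simp add: Let_def sum_bool kp_c_simps)
qed

lemma kp_antipode_basis: "kp_antipode (i, j, k) = basis_vec (if k then (j, i, k) else (i, j, k))"
  by (simp add: basis_vec_def fun_eq_iff)

lemma kp_antipode_conv: 
  "(\<Sum>l\<in>UNIV. \<Sum>m\<in>UNIV. kp_comult i l m * (\<Sum>n\<in>UNIV. kp_antipode l n * kp_mult n m k)) = basis_vec (False, False, False) k"
  "(\<Sum>l\<in>UNIV. \<Sum>m\<in>UNIV. kp_comult i l m * (\<Sum>n\<in>UNIV. kp_antipode m n * kp_mult l n k)) = basis_vec (False, False, False) k"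
proof -
  obtain i1 i2 i3 k1 k2 k3 where
    ijkl: "i = (i1,i2,i3)" "k = (k1,k2,k3)" 
    by (metis prod_cases3)
  have *: "(\<Sum>n\<in>UNIV. kp_antipode (j1,j2,j3) n * f n) = f (if j3 then (j2,j1,j3) else (j1,j2,j3))" for f j1 j2 j3
    by (simp add: kp_antipode_basis sum_delta_left)
  show "(\<Sum>l\<in>UNIV. \<Sum>m\<in>UNIV. kp_comult i l m * (\<Sum>n\<in>UNIV. kp_antipode l n * kp_mult n m k)) = basis_vec (False, False, False) k"
    "(\<Sum>l\<in>UNIV. \<Sum>m\<in>UNIV. kp_comult i l m * (\<Sum>n\<in>UNIV. kp_antipode m n * kp_mult l n k)) = basis_vec (False, False, False) k"
    unfolding ijkl kp_comult_sum *
    by (cases i3; cases k3; cases i1; cases i2; cases k1; cases k2; simp add: kp_c_simps sum_bool basis_vec_def)+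
qed
lemma kac_paljutkin_hopf: "hopf_star_algebra kac_paljutkin"
proof -
  let ?Q = kac_paljutkin
  have sa: "star_algebra ?Q"
    unfolding star_algebra_def Let_def
  proof (intro allI conjI)
    fix i j k
    show "alg_mult ?Q (alg_mult ?Q (basis_vec i) (basis_vec j)) (basis_vec k) =
        alg_mult ?Q (basis_vec i) (alg_mult ?Q (basis_vec j) (basis_vec k))"
      by (simp add: alg_mult_basis)
        (simp add: alg_mult_basis_left alg_mult_basis_right kac_paljutkin_def kp_mult_assoc)
    show "alg_mult ?Q (unit_coeff ?Q) (basis_vec i) = basis_vec i"
      "alg_mult ?Q (basis_vec i) (unit_coeff ?Q) = basis_vec i"
      by (simp_all add: kac_paljutkin_def alg_mult_basis kp_unit)
    show "alg_star ?Q (alg_star ?Q (basis_vec i)) = basis_vec i"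
      by (simp add: alg_star_basis) (simp add: alg_star_def kac_paljutkin_def cnj_kp kp_star_star)
    show "alg_star ?Q (alg_mult ?Q (basis_vec i) (basis_vec j)) =
        alg_mult ?Q (alg_star ?Q (basis_vec j)) (alg_star ?Q (basis_vec i))"
      by (simp add: alg_star_basis alg_mult_basis)
        (simp add: alg_star_def alg_mult_def kac_paljutkin_def cnj_kp kp_star_mult sum_distrib_left mult.assoc)
  qed
  show ?thesis
    unfolding hopf_star_algebra_def Let_def
  proof (intro conjI allI sa)
    show "comult ?Q (unit_coeff ?Q) = tensor_vec (unit_coeff ?Q) (unit_coeff ?Q)"
    proof -
      have "unit_coeff ?Q = basis_vec (False, False, False)"
        by (simp add: kac_paljutkin_def)
      then show ?thesis
        by (simp add: comult_basis tensor_vec_basis) (auto simp: kac_paljutkin_def basis_vec_def fun_eq_iff)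
    qed
    show "counit ?Q (unit_coeff ?Q) = 1"
      by (simp add: kac_paljutkin_def counit_basis)
    fix i j
    show "comult ?Q (alg_mult ?Q (basis_vec i) (basis_vec j)) =
        alg_mult (tensor_alg ?Q ?Q) (comult ?Q (basis_vec i)) (comult ?Q (basis_vec j))"
      by (simp add: alg_mult_basis comult_basis)
        (simp add: comult_def alg_mult_def tensor_alg_def kac_paljutkin_def kp_bialg sum_prod
          sum_distrib_left mult.assoc fun_eq_iff)
    show "counit ?Q (alg_mult ?Q (basis_vec i) (basis_vec j)) = counit ?Q (basis_vec i) * counit ?Q (basis_vec j)"
      by (simp add: alg_mult_basis counit_basis) (simp add: counit_def kac_paljutkin_def kp_counit)
    show "comult ?Q (alg_star ?Q (basis_vec i)) = alg_star (tensor_alg ?Q ?Q) (comult ?Q (basis_vec i))"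
      by (simp add: alg_star_basis comult_basis)
        (simp add: comult_def alg_star_def tensor_alg_def kac_paljutkin_def cnj_kp kp_star_comult sum_prod fun_eq_iff)
    show "comult_id ?Q (comult ?Q (basis_vec i)) = id_comult ?Q (comult ?Q (basis_vec i))"
      by (simp add: comult_basis) (simp add: comult_id_def id_comult_def kac_paljutkin_def kp_comult_coassoc)
    show "(\<lambda>k. \<Sum>l\<in>UNIV. counit_coeff ?Q l * comult ?Q (basis_vec i) (l, k)) = basis_vec i"
      "(\<lambda>k. \<Sum>l\<in>UNIV. comult ?Q (basis_vec i) (k, l) * counit_coeff ?Q l) = basis_vec i"
      by (simp_all add: comult_basis kac_paljutkin_def kp_counit)
    show "(\<lambda>k. \<Sum>l\<in>UNIV. \<Sum>m\<in>UNIV. comult ?Q (basis_vec i) (l, m) *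
          alg_mult ?Q (antipode ?Q (basis_vec l)) (basis_vec m) k) =
        (\<lambda>k. counit ?Q (basis_vec i) * unit_coeff ?Q k)"
      "(\<lambda>k. \<Sum>l\<in>UNIV. \<Sum>m\<in>UNIV. comult ?Q (basis_vec i) (l, m) *
          alg_mult ?Q (basis_vec l) (antipode ?Q (basis_vec m)) k) =
        (\<lambda>k. counit ?Q (basis_vec i) * unit_coeff ?Q k)"
      by (simp_all add: comult_basis counit_basis antipode_basis alg_mult_basis_left alg_mult_basis_right
          kac_paljutkin_def kp_antipode_conv)
  qed
qed

end

theory Submission
  imports Defs
begin

text \<open>
  Why both groups are trivial. As a coalgebra, the Kac--Paljutkin algebra \<open>Q\<close> is the sum of the four
  group-like elements \<open>1, x, y, xy\<close>, which form the Klein group \<open>A\<close>, and of the \<open>2 \<times> 2\<close> matrix coalgebra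
  spanned by the monomials \<open>hz\<close> with \<open>h\<close> in \<open>A\<close>. Dually, the algebra of \<open>Q^\<close> is \<open>\<complex>\<^sup>4 \<oplus> M\<^sub>2\<close>: its simple
  modules are the elements of \<open>A\<close> and one two-dimensional \<open>m\<close>. An element \<open>w\<close> of \<open>Q^ \<otimes> Q^\<close> is a bilinear
  form on \<open>Q\<close>; products become convolutions, \<open>\<Delta>(f)\<close> becomes the form \<open>(a, b) \<mapsto> f(ab)\<close>, and the cocycle
  identity reads
  \<open>\<Sum> w(b\<^sub>1, c\<^sub>1) w(a, b\<^sub>2 c\<^sub>2) = \<Sum> w(a\<^sub>1, b\<^sub>1) w(a\<^sub>2 b\<^sub>2, c)\<close>.

  An invariant \<open>w\<close> acts on \<open>U \<otimes> V\<close> by a module endomorphism for all simple \<open>U\<close> and \<open>V\<close>, and these tensor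
  products are multiplicity free (\<open>g \<otimes> m = m \<otimes> g = m\<close>, \<open>m \<otimes> m = \<Sum>\<^sub>h h\<close>), so \<open>w\<close> is a family of scalars:
  \<open>w(g, h)\<close>, \<open>l(g)\<close> on \<open>g \<otimes> m\<close>, \<open>r(g)\<close> on \<open>m \<otimes> g\<close>, and \<open>T(h)\<close> on the summand \<open>h\<close> of \<open>m \<otimes> m\<close>. The cocycle identity
  at \<open>(g, h, m)\<close> gives \<open>w(g, h) = l(g) l(h) / l(gh)\<close>, and at \<open>(m, g, h)\<close> it gives the same with \<open>r\<close>, so that
  \<open>r / l\<close> is a character of \<open>A\<close>. By the identity at \<open>(m, g, m)\<close> this character twists \<open>w\<close> on \<open>m \<otimes> m\<close>
  when \<open>g\<close> is moved across the tensor sign; invariance rules out a nontrivial twist, whence \<open>l = r\<close>.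
  Finally \<open>(g, m, m)\<close> gives \<open>T(h) l(h) = T(gh) l(gh)\<close>, so \<open>T = \<tau> / l\<close> for a constant \<open>\<tau> \<noteq> 0\<close>. These are
  exactly the scalars of the coboundary of the central element \<open>v\<close> that equals \<open>l(g)\<close> on \<open>g\<close> and a square
  root of \<open>\<tau>\<close> on \<open>m\<close> (lemma \<open>w_eq_cobound\<close>). If the coboundary of \<open>v\<close> is unitary, then so is \<open>v\<close>
  (lemma \<open>unitary_cobound\<close>), which settles the unitary version.
\<close>


section \<open>The dual algebra as functions on monomials\<close>

abbreviation kp_dual :: "kp_index hopf_star_alg" where
  "kp_dual \<equiv> dual_hopf kac_paljutkin"

text \<open>The Sweedler sum \<open>\<Sum> F(a\<^sub>1, a\<^sub>2)\<close> for the basis monomial \<open>a\<close> with index \<open>i\<close>.\<close>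

definition sweedler :: "kp_index \<Rightarrow> (kp_index \<Rightarrow> kp_index \<Rightarrow> complex) \<Rightarrow> complex" where
  "sweedler i F = (\<Sum>a\<in>UNIV. \<Sum>b\<in>UNIV. kp_comult i a b * F a b)"

text \<open>The coordinates of \<open>\<Delta>(f)\<close> in the dual: the values of \<open>f\<close> at products of monomials.\<close>

definition prod_val :: "(kp_index \<Rightarrow> complex) \<Rightarrow> kp_index \<Rightarrow> kp_index \<Rightarrow> complex" where
  "prod_val f i j = (\<Sum>m\<in>UNIV. kp_mult i j m * f m)"

lemma sweedler_simps [simp]:
  "sweedler (i, j, False) F = F (i, j, False) (i, j, False)"
  "sweedler (i, j, True) F =
     (F (i, j, True) (i, j, True) + F (i, j, True) (\<not> i, j, True) +
      F (i, \<not> j, True) (i, j, True) - F (i, \<not> j, True) (\<not> i, j, True)) / 2"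
  unfolding sweedler_def kp_comult_sum
  by (simp_all add: sum_bool kp_c_simps add_divide_distrib diff_divide_distrib)

lemma prod_val_simps [simp]:
  "prod_val f (i, j, False) (p, q, r) = f (i \<noteq> p, j \<noteq> q, r)"
  "prod_val f (i, j, True) (p, q, False) = f (i \<noteq> q, j \<noteq> p, True)"
  "prod_val f (i, j, True) (p, q, True) =
     (f (i \<noteq> q, j \<noteq> p, False) + f (i \<noteq> q, j = p, False) +
      f (i = q, j \<noteq> p, False) - f (i = q, j = p, False)) / 2"
  unfolding prod_val_def kp_mult_sum
  by (simp_all add: Let_def sum_bool kp_c_simps add_divide_distrib diff_divide_distrib)

text \<open>Orients equations between exponents, so that equal arguments of a function become syntactically equal.\<close>

lemma negation_eq_iff: "((\<not> a) = b) = (a = (\<not> b))" for a b :: bool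
  by blast

lemma kp_index_cases:
  obtains i j where "k = (i, j, False)" | i j where "k = (i, j, True)"
  by (cases k) auto

lemma sweedler_counit:
  "sweedler i (\<lambda>a b. F a) = F i" "sweedler i (\<lambda>a b. F b) = F i"
  by (cases i rule: kp_index_cases; simp)+

lemma sweedler_mult_left: "sweedler i (\<lambda>a b. c * F a b) = c * sweedler i F"
  by (simp add: sweedler_def sum_distrib_left mult_ac)

lemma alg_mult_dual: "alg_mult kp_dual \<phi> \<psi> k = sweedler k (\<lambda>a b. \<phi> a * \<psi> b)"
  by (simp add: alg_mult_def dual_hopf_def kac_paljutkin_def sweedler_def mult_ac)

text \<open>
  With the second factor left arbitrary, the same rule unfolds convolution on two and on three tensor factors.
\<close>

lemma alg_mult_dual_tensor:
  "alg_mult (tensor_alg kp_dual B) x y (i, r) =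
     sweedler i (\<lambda>a b. alg_mult B (\<lambda>p. x (a, p)) (\<lambda>p. y (b, p)) r)"
proof -
  have "alg_mult (tensor_alg kp_dual B) x y (i, r) =
     (\<Sum>a\<in>UNIV. \<Sum>p\<in>UNIV. \<Sum>b\<in>UNIV. \<Sum>q\<in>UNIV. kp_comult i a b * (x (a, p) * y (b, q) * mult_coeff B p q r))"
    by (simp add: alg_mult_def tensor_alg_def sum_prod dual_hopf_def kac_paljutkin_def mult_ac)
  also have "\<dots> = (\<Sum>a\<in>UNIV. \<Sum>b\<in>UNIV. \<Sum>p\<in>UNIV. \<Sum>q\<in>UNIV. kp_comult i a b * (x (a, p) * y (b, q) * mult_coeff B p q r))"
    by (intro sum.cong refl sum.swap)
  finally show ?thesis
    by (simp add: sweedler_def alg_mult_def sum_distrib_left)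
qed

lemma comult_dual: "comult kp_dual \<phi> (i, j) = prod_val \<phi> i j"
  by (simp add: comult_def dual_hopf_def kac_paljutkin_def prod_val_def mult.commute)

lemma unit_dual: "unit_coeff kp_dual = (\<lambda>_. 1)"
  by (simp add: dual_hopf_def kac_paljutkin_def)

lemma unit_dual_tensor: "unit_coeff (tensor_alg kp_dual kp_dual) = (\<lambda>_. 1)"
  by (auto simp: tensor_alg_def unit_dual tensor_vec_def)

lemma alg_mult_dual_dual:
  "alg_mult (tensor_alg kp_dual kp_dual) x y (i, j) =
     sweedler i (\<lambda>a b. sweedler j (\<lambda>c d. x (a, c) * y (b, d)))"
  by (simp add: alg_mult_dual_tensor alg_mult_dual)

text \<open>Multiplicativity of the comultiplication of the dual: \<open>\<Sum> f(a\<^sub>1 b\<^sub>1) g(a\<^sub>2 b\<^sub>2) = (f g)(ab)\<close>.\<close>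

lemma prod_val_convolution:
  "sweedler i (\<lambda>a b. sweedler j (\<lambda>c d. prod_val f a c * prod_val g b d)) =
   prod_val (alg_mult kp_dual f g) i j"
  unfolding alg_mult_dual
proof (cases i rule: kp_index_cases; cases j rule: kp_index_cases)
  fix p q r s assume *: "i = (p, q, True)" "j = (r, s, True)"
  show "sweedler i (\<lambda>a b. sweedler j (\<lambda>c d. prod_val f a c * prod_val g b d)) =
    prod_val (\<lambda>k. sweedler k (\<lambda>a b. f a * g b)) i j"
    unfolding * by (simp add: negation_eq_iff;
      simp add: add_divide_distrib diff_divide_distrib algebra_simps)
qed (simp; simp add: add_divide_distrib diff_divide_distrib algebra_simps)+

text \<open>
  \<open>f\<^sup>*(a)\<close> is the conjugate of \<open>f(S(a)\<^sup>*)\<close>. Here \<open>S(h)\<^sup>* = h\<close> for \<open>h\<close> in \<open>A\<close>, while \<open>S(hz)\<^sup>* = h z\<^sup>-\<^sup>1\<close>, and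
  \<open>z\<^sup>-\<^sup>1 = (z + xz + yz - xyz) / 2\<close>.
\<close>

lemma alg_star_dual:
  "alg_star kp_dual f (p, q, r) =
    (if r then (cnj (f (p, q, True)) + cnj (f (p, \<not> q, True)) +
       cnj (f (\<not> p, q, True)) - cnj (f (\<not> p, \<not> q, True))) / 2
     else cnj (f (p, q, False)))"
proof -
  have "star_coeff kp_dual i (p, q, r) = kp_star (if r then (q, p, r) else (p, q, r)) i" for i
    by (simp only: dual_hopf_def hopf_star_alg.simps star_alg.simps antipode_basis)
      (simp add: kac_paljutkin_def kp_antipode_basis alg_star_basis cnj_kp)
  then have "alg_star kp_dual f (p, q, r) =
      (\<Sum>i\<in>UNIV. kp_star (if r then (q, p, r) else (p, q, r)) i * cnj (f i))"
    by (simp only: alg_star_def mult.commute)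
  then show ?thesis
    by (cases r) (simp_all only: if_True if_False kp_star_sum,
      simp_all add: sum_bool kp_c_simps add_divide_distrib diff_divide_distrib)
qed

lemma alg_star_dual_tensor:
  "alg_star (tensor_alg kp_dual B) x (j, r) = alg_star kp_dual (\<lambda>i. cnj (alg_star B (\<lambda>p. x (i, p)) r)) j"
  by (simp add: alg_star_def tensor_alg_def sum_prod sum_distrib_right sum_distrib_left mult_ac)

lemma mult_monoid_simps [simp]:
  "carrier (mult_monoid A) = UNIV" "mult (mult_monoid A) = alg_mult A" "one (mult_monoid A) = unit_coeff A"
  by (simp_all add: mult_monoid_def)

lemma dual_monoid: "monoid (mult_monoid kp_dual)"
proof (rule monoidI)
  fix x y z
  show "mult (mult_monoid kp_dual) (mult (mult_monoid kp_dual) x y) z =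
      mult (mult_monoid kp_dual) x (mult (mult_monoid kp_dual) y z)"
  proof
    fix k show "mult (mult_monoid kp_dual) (mult (mult_monoid kp_dual) x y) z k =
      mult (mult_monoid kp_dual) x (mult (mult_monoid kp_dual) y z) k"
      by (cases k rule: kp_index_cases)
        (simp_all add: alg_mult_dual add_divide_distrib diff_divide_distrib algebra_simps)
  qed
qed (simp_all add: alg_mult_dual unit_dual fun_eq_iff sweedler_counit)

section \<open>Central elements and their coboundaries\<close>

text \<open>
  The unit of the \<open>M\<^sub>2\<close> block takes the value 1, the counit, at every monomial \<open>hz\<close>. Hence the scalar
  multiples of the identity in that block are the functions constant on these monomials.
\<close>

definition block_scalar :: "(kp_index \<Rightarrow> complex) \<Rightarrow> bool" where
  "block_scalar v \<longleftrightarrow> (\<exists>\<mu>. \<forall>i j. v (i, j, True) = \<mu>)"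

lemma block_scalar_mult: "block_scalar u \<Longrightarrow> block_scalar v \<Longrightarrow> block_scalar (\<lambda>i. u i * v i)"
  by (auto simp: block_scalar_def)

lemma block_scalar_comp: "block_scalar v \<Longrightarrow> block_scalar (\<lambda>i. f (v i))"
  by (auto simp: block_scalar_def)

text \<open>
  Each summand of \<open>\<complex>\<^sup>4 \<oplus> M\<^sub>2\<close> is dual to a subcoalgebra, so a function that is a scalar on each summand can be
  pulled out of a Sweedler sum. This reduces all computations with central elements to pointwise ones.
\<close>

lemma sweedler_block_scalar:
  assumes "block_scalar v"
  shows "sweedler i (\<lambda>a b. v a * F a b) = v i * sweedler i F"
    and "sweedler i (\<lambda>a b. v b * F a b) = v i * sweedler i F"
proof -
  obtain \<mu> where "\<And>i j. v (i, j, True) = \<mu>" using assms by (auto simp: block_scalar_def)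
  then show "sweedler i (\<lambda>a b. v a * F a b) = v i * sweedler i F"
    "sweedler i (\<lambda>a b. v b * F a b) = v i * sweedler i F"
    by (cases i rule: kp_index_cases; simp add: algebra_simps)+
qed

lemma alg_mult_block_scalar:
  assumes "block_scalar v"
  shows "alg_mult kp_dual v f = (\<lambda>i. v i * f i)" "alg_mult kp_dual f v = (\<lambda>i. v i * f i)"
proof
  fix i
  show "alg_mult kp_dual v f i = v i * f i"
    by (simp add: alg_mult_dual sweedler_block_scalar[OF assms] sweedler_counit)
next
  show "alg_mult kp_dual f v = (\<lambda>i. v i * f i)"
    by (simp add: fun_eq_iff alg_mult_dual mult.commute[of "f _"] sweedler_block_scalar[OF assms] sweedler_counit)
qed

lemma central_iff: "central kp_dual v \<longleftrightarrow> block_scalar v"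
proof
  assume "central kp_dual v"
  then have c: "sweedler k (\<lambda>a b. v a * f b) = sweedler k (\<lambda>a b. f a * v b)" for f k
    by (metis central_def alg_mult_dual)
  \<comment> \<open>The test vectors are dual to a monomial that occurs in only one leg of \<open>\<Delta>\<close>, so one side of the relation vanishes.\<close>
  have "v (i, j, True) = v (i, \<not> j, True)" for i j
    using c[of "(i, j, True)" "basis_vec (\<not> i, j, True)"] by (simp add: basis_vec_def)
  moreover have "v (i, j, True) = v (\<not> i, j, True)" for i j
    using c[of "(i, j, True)" "basis_vec (i, \<not> j, True)"] by (simp add: basis_vec_def)
  ultimately have "v (i, j, True) = v (False, False, True)" for i j
    by (cases i; cases j) (metis (full_types))+
  then show "block_scalar v" by (auto simp: block_scalar_def)
qed (simp add: central_def alg_mult_block_scalar)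

text \<open>
  The coboundary \<open>(v \<otimes> v) \<Delta>(v\<^sup>-\<^sup>1)\<close> of a central \<open>v\<close>: multiplication by \<open>v \<otimes> v\<close> and inversion
  are pointwise.
\<close>

definition cobound :: "(kp_index \<Rightarrow> complex) \<Rightarrow> kp_index \<times> kp_index \<Rightarrow> complex" where
  "cobound v = (\<lambda>(i, j). v i * v j * prod_val (\<lambda>m. inverse (v m)) i j)"

lemma central_unit_iff:
  "v \<in> Units (mult_monoid kp_dual) \<and> central kp_dual v \<longleftrightarrow> block_scalar v \<and> (\<forall>i. v i \<noteq> 0)"
proof safe
  fix a b c assume "v \<in> Units (mult_monoid kp_dual)" "central kp_dual v"
    and *: "v (a, b, c) = 0"
  then obtain u where "alg_mult kp_dual v u = (\<lambda>_. 1)" and "block_scalar v"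
    by (auto simp: Units_def unit_dual central_iff)
  with * show False by (metis alg_mult_block_scalar(1) mult_zero_left zero_neq_one)
next
  assume *: "block_scalar v" "\<forall>i. v i \<noteq> 0"
  show "v \<in> Units (mult_monoid kp_dual)"
    using * by (auto simp: Units_def unit_dual alg_mult_block_scalar intro!: exI[of _ "\<lambda>i. inverse (v i)"])
qed (simp_all add: central_iff)

lemma coboundary_eq_cobound:
  assumes "block_scalar v" "\<forall>i. v i \<noteq> 0"
  shows "coboundary kp_dual v = cobound v"
proof -
  interpret monoid "mult_monoid kp_dual" by (rule dual_monoid)
  have "inv\<^bsub>mult_monoid kp_dual\<^esub> v = (\<lambda>i. inverse (v i))"
    by (rule inv_unique'[symmetric]) (use assms in \<open>simp_all add: alg_mult_block_scalar unit_dual fun_eq_iff\<close>)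
  then show ?thesis
    by (simp only: coboundary_def)
      (auto intro!: ext simp: cobound_def alg_mult_dual_dual tensor_vec_def comult_dual
        sweedler_block_scalar[OF assms(1)] sweedler_mult_left sweedler_counit mult.assoc)
qed

lemma cobound_mult:
  assumes "block_scalar u" "block_scalar v"
  shows "alg_mult (tensor_alg kp_dual kp_dual) (cobound u) (cobound v) = cobound (\<lambda>i. u i * v i)"
proof (safe intro!: ext)
  fix i j :: kp_index
  let ?u = "\<lambda>i. inverse (u i)" and ?v = "\<lambda>i. inverse (v i)"
  have "alg_mult (tensor_alg kp_dual kp_dual) (cobound u) (cobound v) (i, j) =
      sweedler i (\<lambda>a b. u a * (v b * sweedler j (\<lambda>c d. u c * (v d * (prod_val ?u a c * prod_val ?v b d)))))"
    unfolding alg_mult_dual_dual cobound_def split sweedler_def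
    by (simp add: sum_distrib_left mult_ac)
  also have "\<dots> = u i * v i * u j * v j *
      sweedler i (\<lambda>a b. sweedler j (\<lambda>c d. prod_val ?u a c * prod_val ?v b d))"
    by (simp add: sweedler_block_scalar sweedler_mult_left assms)
  also have "sweedler i (\<lambda>a b. sweedler j (\<lambda>c d. prod_val ?u a c * prod_val ?v b d)) =
      prod_val (alg_mult kp_dual ?u ?v) i j"
    by (rule prod_val_convolution)
  finally show "alg_mult (tensor_alg kp_dual kp_dual) (cobound u) (cobound v) (i, j) = cobound (\<lambda>i. u i * v i) (i, j)"
    by (simp add: cobound_def alg_mult_block_scalar block_scalar_comp assms)
qed

lemma cobound_one: "cobound (\<lambda>_. 1) = (\<lambda>_. 1)"
proof (safe intro!: ext)
  fix i j show "cobound (\<lambda>_. 1) (i, j) = 1"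
    by (cases i rule: kp_index_cases; cases j rule: kp_index_cases; simp add: cobound_def)
qed

text \<open>
  The scalars \<open>v \<otimes> v\<close> are conjugated pointwise, and the form \<open>(a, b) \<mapsto> v\<^sup>-\<^sup>1(ab)\<close> is compatible with the star
  because \<open>a \<mapsto> S(a)\<^sup>*\<close> is multiplicative.
\<close>

lemma cobound_star:
  assumes "block_scalar v"
  shows "alg_star (tensor_alg kp_dual kp_dual) (cobound v) = cobound (\<lambda>i. cnj (v i))"
proof (safe intro!: ext)
  fix i j :: kp_index
  obtain \<mu> where \<mu>: "\<And>i j. v (i, j, True) = \<mu>" using assms by (auto simp: block_scalar_def)
  obtain i1 i2 i3 j1 j2 j3 where ij: "i = (i1, i2, i3)" "j = (j1, j2, j3)"
    by (metis prod_cases3)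
  show "alg_star (tensor_alg kp_dual kp_dual) (cobound v) (i, j) = cobound (\<lambda>i. cnj (v i)) (i, j)"
    unfolding ij alg_star_dual_tensor alg_star_dual cobound_def
    by (cases i3; cases j3; simp add: \<mu> negation_eq_iff; simp add: add_divide_distrib diff_divide_distrib algebra_simps)
qed

section \<open>Every invariant cocycle is the coboundary of a central element\<close>

locale kp_invariant_cocycle =
  fixes w :: "kp_index \<times> kp_index \<Rightarrow> complex"
  assumes cocycle: "two_cocycle kp_dual w" and inv: "invariant kp_dual w"
begin

lemma invariant_eq:
  "sweedler i (\<lambda>a a'. sweedler j (\<lambda>b b'. w (a, b) * prod_val f a' b')) =
   sweedler i (\<lambda>a a'. sweedler j (\<lambda>b b'. prod_val f a b * w (a', b')))"
  using inv unfolding invariant_def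
  by (metis (no_types, lifting) ext alg_mult_dual_dual comult_dual)

lemma cocycle_eq:
  "sweedler j (\<lambda>b b'. sweedler k (\<lambda>c c'. w (b, c) * prod_val (\<lambda>l. w (i, l)) b' c')) =
   sweedler i (\<lambda>a a'. sweedler j (\<lambda>b b'. w (a, b) * prod_val (\<lambda>l. w (l, k)) a' b'))"
proof -
  have 1: "id_comult kp_dual w (i, j, k) = prod_val (\<lambda>l. w (i, l)) j k"
    "comult_id kp_dual w (i, j, k) = prod_val (\<lambda>l. w (l, k)) i j" for i j k
    by (simp_all add: id_comult_def comult_id_def dual_hopf_def kac_paljutkin_def prod_val_def mult.commute)
  have "alg_mult (tensor_alg kp_dual (tensor_alg kp_dual kp_dual)) (tensor_unit_left kp_dual w) (id_comult kp_dual w) (i, j, k) =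
     alg_mult (tensor_alg kp_dual (tensor_alg kp_dual kp_dual)) (tensor_unit_right kp_dual w) (comult_id kp_dual w) (i, j, k)"
    using cocycle by (simp add: two_cocycle_def)
  then show ?thesis
    by (simp add: alg_mult_dual_tensor alg_mult_dual 1 tensor_unit_left_def tensor_unit_right_def unit_dual sweedler_counit)
qed

lemma inverse_eq:
  obtains w' where "\<And>i j. sweedler i (\<lambda>a a'. sweedler j (\<lambda>b b'. w (a, b) * w' (a', b'))) = 1"
proof -
  obtain w' where "alg_mult (tensor_alg kp_dual kp_dual) w w' = (\<lambda>_. 1)"
    using cocycle by (auto simp: two_cocycle_def Units_def unit_dual_tensor)
  then show ?thesis using that alg_mult_dual_dual by metis
qed

text \<open>The scalars \<open>l(g)\<close> and \<open>r(g)\<close> by which \<open>w\<close> acts on \<open>g \<otimes> m\<close> and \<open>m \<otimes> g\<close>.\<close>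

definition left_scalar :: "bool \<Rightarrow> bool \<Rightarrow> complex" where
  "left_scalar p q = w ((p, q, False), (False, False, True))"

definition right_scalar :: "bool \<Rightarrow> bool \<Rightarrow> complex" where
  "right_scalar p q = w ((False, False, True), (p, q, False))"

text \<open>
  Invariance says that \<open>w(g, \<cdot>)\<close> restricted to the matrix coalgebra lies in the centre of \<open>M\<^sub>2\<close>, so it is a scalar
  multiple of the counit. Two test functionals, each supported at one monomial, suffice.
\<close>

lemma w_group_block: "w ((p, q, False), (i, j, True)) = left_scalar p q"
proof -
  let ?f = "\<lambda>i j. w ((p, q, False), (i, j, True))"
  have "?f i j = ?f i (\<not> j)" for i j
    using invariant_eq[of "(p, q, False)" "(i, j, True)" "basis_vec (p = i, q \<noteq> j, True)"]
    by (cases p; cases q; cases i; cases j; simp add: basis_vec_def)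
  moreover have "?f i j = ?f (\<not> i) j" for i j
    using invariant_eq[of "(p, q, False)" "(i, j, True)" "basis_vec (p \<noteq> i, q = j, True)"]
    by (cases p; cases q; cases i; cases j; simp add: basis_vec_def)
  ultimately show ?thesis unfolding left_scalar_def by (cases i; cases j) (metis (full_types))+
qed

lemma w_block_group: "w ((i, j, True), (p, q, False)) = right_scalar p q"
proof -
  let ?f = "\<lambda>i j. w ((i, j, True), (p, q, False))"
  have "?f i j = ?f i (\<not> j)" for i j
    using invariant_eq[of "(i, j, True)" "(p, q, False)" "basis_vec (q = i, p \<noteq> j, True)"]
    by (cases p; cases q; cases i; cases j; simp add: basis_vec_def)
  moreover have "?f i j = ?f (\<not> i) j" for i j
    using invariant_eq[of "(i, j, True)" "(p, q, False)" "basis_vec (q \<noteq> i, p = j, True)"]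
    by (cases p; cases q; cases i; cases j; simp add: basis_vec_def)
  ultimately show ?thesis unfolding right_scalar_def by (cases i; cases j) (metis (full_types))+
qed

text \<open>Since \<open>w(g, \<cdot>)\<close> is \<open>l(g)\<close> times the counit, the equation \<open>(w w')(g, z) = 1\<close> has \<open>l(g)\<close> as a factor.\<close>

lemma left_scalar_nonzero: "left_scalar p q \<noteq> 0"
proof -
  obtain w' where *: "\<And>i j. sweedler i (\<lambda>a a'. sweedler j (\<lambda>b b'. w (a, b) * w' (a', b'))) = 1"
    using inverse_eq by blast
  show ?thesis using *[of "(p, q, False)" "(False, False, True)"] by (auto simp: w_group_block)
qed

text \<open>The cocycle identity at \<open>(g, h, z)\<close>; the lemma after it is the one at \<open>(z, g, h)\<close>.\<close>

lemma left_scalar_mult: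
  "w ((i, j, False), (p, q, False)) * left_scalar (i \<noteq> p) (j \<noteq> q) = left_scalar i j * left_scalar p q"
  using cocycle_eq[of "(p, q, False)" "(False, False, True)" "(i, j, False)"]
  by (simp add: w_group_block mult.commute)

lemma right_scalar_mult:
  "w ((i, j, False), (p, q, False)) * right_scalar (i \<noteq> p) (j \<noteq> q) = right_scalar i j * right_scalar p q"
  using cocycle_eq[of "(i, j, False)" "(p, q, False)" "(False, False, True)"]
  by (simp add: w_block_group)

text \<open>
  The cocycle identity at \<open>(k, g, k')\<close> for block monomials \<open>k\<close> and \<open>k'\<close>: it is \<open>l(g) w(k, gk') = r(g) w(kg, k')\<close>, where the
  exponents of \<open>g\<close> are exchanged in \<open>kg\<close> because \<open>zx = yz\<close> and \<open>zy = xz\<close>.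
\<close>

lemma move_group_element:
  "left_scalar i j * w ((p, q, True), (i \<noteq> r, j \<noteq> s, True)) =
   right_scalar i j * w ((p \<noteq> j, q \<noteq> i, True), (r, s, True))"
  using cocycle_eq[of "(i, j, False)" "(r, s, True)" "(p, q, True)"] by (simp add: w_group_block w_block_group algebra_simps)

text \<open>
  If the values \<open>w(hz, z)\<close> all vanished, then \<open>w\<close> would vanish on the whole \<open>M\<^sub>2 \<otimes> M\<^sub>2\<close> block, where it is invertible.
\<close>

lemma w_block_block_nonzero: "\<exists>p q. w ((p, q, True), (False, False, True)) \<noteq> 0"
proof (rule ccontr)
  assume "\<nexists>p q. w ((p, q, True), (False, False, True)) \<noteq> 0"
  then have z: "w ((p, q, True), (i, j, True)) = 0" for p q i j
    using move_group_element[of i j p q False False] left_scalar_nonzero[of i j] by simp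
  obtain w' where *: "\<And>i j. sweedler i (\<lambda>a a'. sweedler j (\<lambda>b b'. w (a, b) * w' (a', b'))) = 1"
    using inverse_eq by blast
  show False using *[of "(False, False, True)" "(False, False, True)"] by (simp add: z)
qed

text \<open>
  Let \<open>\<chi> = r / l\<close>. By the previous lemmas \<open>w(hz, h'z)\<close> is determined by the numbers \<open>t(h) = w(hz, z)\<close> and \<open>\<chi>\<close>. In
  \<open>\<Delta>(hz)\<close> the left legs are \<open>hz\<close> and \<open>hyz\<close> and the right legs \<open>hz\<close> and \<open>hxz\<close>, so the two sides of the invariance
  identity at \<open>(hz, z)\<close> use \<open>\<chi>(y)\<close> and \<open>\<chi>(x)\<close> respectively. Evaluating them on the characters of \<open>A\<close> is a Fourier
  inversion that leaves \<open>\<chi>(y)\<^sup>u t(h x\<^sup>u y\<^sup>u\<^sup>') = \<chi>(x)\<^sup>u\<^sup>' t(h x\<^sup>u y\<^sup>u\<^sup>')\<close>, and \<open>t\<close> does not vanish identically.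
\<close>

lemma characters_agree_on_generators:
  "right_scalar False True = left_scalar False True"
  "right_scalar True False = left_scalar True False"
proof -
  let ?t = "\<lambda>u v. w ((u, v, True), (False, False, True))"
  \<comment> \<open>The character \<open>x\<^sup>u y\<^sup>v \<mapsto> (-1)\<^sup>\<alpha>\<^sup>u\<^sup>+\<^sup>\<beta>\<^sup>v\<close> of \<open>A\<close>, extended by zero.\<close>
  let ?f = "\<lambda>\<alpha> \<beta> (u, v, k). if k then 0 else if (\<alpha> \<and> u) \<noteq> (\<beta> \<and> v) then - 1 else (1::complex)"
  define y x where "y = right_scalar False True / left_scalar False True"
    and "x = right_scalar True False / left_scalar True False"
  then have y: "right_scalar False True = y * left_scalar False True"
    and x: "right_scalar True False = x * left_scalar True False"
    by (simp_all add: left_scalar_nonzero)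
  have wy: "w ((p, q, True), (False, True, True)) = y * ?t (\<not> p) q" for p q
    using move_group_element[of False True p q False False] left_scalar_nonzero[of False True] by (simp add: y)
  have wx: "w ((p, q, True), (True, False, True)) = x * ?t p (\<not> q)" for p q
    using move_group_element[of True False p q False False] left_scalar_nonzero[of True False] by (simp add: x)
  obtain p q where T: "?t p q \<noteq> 0" using w_block_block_nonzero by blast
  \<comment> \<open>The cases \<open>(u, u') = (1, 0)\<close> and, below, \<open>(u, u') = (0, 1)\<close>; \<open>h\<close> is shifted so that \<open>t\<close> is evaluated at \<open>x\<^sup>p y\<^sup>q\<close>.\<close>
  have "y * ?t p q = ?t p q"
    using invariant_eq[of "(\<not> p, q, True)" "(False, False, True)" "?f False True"]
    by (cases p; cases q; simp add: wx wy)
  then show "right_scalar False True = left_scalar False True" using T by (simp add: y)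
  have "x * ?t p q = ?t p q"
    using invariant_eq[of "(p, \<not> q, True)" "(False, False, True)" "?f True False"]
    by (cases p; cases q; simp add: wx wy)
  then show "right_scalar True False = left_scalar True False" using T by (simp add: x)
qed

text \<open>Both \<open>l\<close> and \<open>r\<close> trivialize \<open>w\<close> on \<open>A\<close>, so they differ by a character, which is trivial on \<open>x\<close> and \<open>y\<close>.\<close>

lemma left_eq_right_scalar: "right_scalar i j = left_scalar i j"
proof -
  have "w ((False, False, False), (False, False, False)) = left_scalar False False"
    using left_scalar_mult[of False False False False] left_scalar_nonzero[of False False] by simp
  then have 1: "right_scalar False False = left_scalar False False"
    using right_scalar_mult[of False True False False] left_scalar_nonzero[of False True] left_scalar_nonzero[of False False]
      left_scalar_mult[of False True False False]
    by (simp add: characters_agree_on_generators)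
  have xy: "w ((True, False, False), (False, True, False)) * left_scalar True True = left_scalar True False * left_scalar False True"
    "w ((True, False, False), (False, True, False)) * right_scalar True True = left_scalar True False * left_scalar False True"
    using left_scalar_mult[of True False False True] right_scalar_mult[of True False False True]
    by (simp_all add: characters_agree_on_generators)
  then have "w ((True, False, False), (False, True, False)) \<noteq> 0"
    using left_scalar_nonzero by (metis mult_eq_0_iff)
  with xy have "right_scalar True True = left_scalar True True" by (metis mult_cancel_left)
  with 1 characters_agree_on_generators show ?thesis by (cases i; cases j) auto
qed

text \<open>
  The functional \<open>T\<close> on the span of \<open>A\<close> with \<open>w(k, k') = T(kk')\<close> for block monomials. Taking \<open>k' = z\<close> forces
  \<open>T(h z\<^sup>2) = w(hz, z)\<close>, and \<open>z\<^sup>4 = 1\<close> turns this into \<open>T(h) = w(h z\<^sup>2 z, z)\<close>, with \<open>z\<^sup>2 = (1 + x + y - xy) / 2\<close>.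
\<close>

definition fusion_functional :: "kp_index \<Rightarrow> complex" where
  "fusion_functional = (\<lambda>(u, v, k::bool).
   (w ((u, v, True), (False, False, True)) + w ((u, \<not> v, True), (False, False, True)) +
    w ((\<not> u, v, True), (False, False, True)) - w ((\<not> u, \<not> v, True), (False, False, True))) / 2)"

lemma w_block_block: "w ((p, q, True), (r, s, True)) = prod_val fusion_functional (p, q, True) (r, s, True)"
proof -
  have "w ((p, q, True), (r, s, True)) = w ((p \<noteq> s, q \<noteq> r, True), (False, False, True))"
    using move_group_element[of r s p q False False] left_scalar_nonzero[of r s] by (simp add: left_eq_right_scalar)
  then show ?thesis by (simp add: fusion_functional_def field_simps)
qed

text \<open>
  The cocycle identity at \<open>(g, k, k')\<close>. Its left side is the convolution of the forms \<open>T(kk')\<close> and \<open>w(g, kk')\<close>, that is, the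
  product of the functionals \<open>T\<close> and \<open>w(g, \<cdot>)\<close> evaluated at \<open>kk'\<close>, and its right side is \<open>l(g) T(g k k')\<close>. The products
  \<open>kz\<close> span the span of \<open>A\<close>, so the functionals can be compared at group elements.
\<close>

lemma fusion_functional_mult:
  "fusion_functional (p, q, False) * w ((i, j, False), (p, q, False)) =
   left_scalar i j * fusion_functional (i \<noteq> p, j \<noteq> q, False)"
proof -
  let ?g = "(i, j, False)" and ?z = "(False, False, True)"
  let ?F = "\<lambda>m. fusion_functional m * w (?g, m)"
    and ?G = "\<lambda>(u, v, k::bool). left_scalar i j * fusion_functional (i \<noteq> u, j \<noteq> v, False)"
  have *: "prod_val ?F (u, v, True) ?z = prod_val ?G (u, v, True) ?z" for u v
  proof -
    let ?k = "(u, v, True)"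
    have "prod_val ?F ?k ?z = prod_val (alg_mult kp_dual fusion_functional (\<lambda>m. w (?g, m))) ?k ?z"
      by (simp add: alg_mult_dual)
    also have "\<dots> = sweedler ?k (\<lambda>a a'. sweedler ?z (\<lambda>b b'. prod_val fusion_functional a b * prod_val (\<lambda>m. w (?g, m)) a' b'))"
      by (simp only: prod_val_convolution)
    also have "\<dots> = sweedler ?k (\<lambda>a a'. sweedler ?z (\<lambda>b b'. w (a, b) * prod_val (\<lambda>m. w (?g, m)) a' b'))"
      by (simp only: sweedler_simps w_block_block)
    also have "\<dots> = left_scalar i j * w ((i \<noteq> u, j \<noteq> v, True), ?z)"
      using cocycle_eq[of ?k ?z ?g] by (simp add: w_group_block)
    also have "\<dots> = prod_val ?G ?k ?z"
      by (simp add: w_block_block negation_eq_iff algebra_simps add_divide_distrib diff_divide_distrib)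
    finally show ?thesis .
  qed
  \<comment> \<open>This is \<open>h = (h z\<^sup>2 z) z\<close>.\<close>
  have inversion: "f (u, v, False) = (prod_val f (u, v, True) ?z + prod_val f (u, \<not> v, True) ?z +
      prod_val f (\<not> u, v, True) ?z - prod_val f (\<not> u, \<not> v, True) ?z) / 2" for f u v
    by (simp add: field_simps)
  have "f (p, q, False) = g (p, q, False)"
    if "\<And>u v. prod_val f (u, v, True) ?z = prod_val g (u, v, True) ?z" for f g
    by (simp only: inversion[of f] inversion[of g] that)
  from this[of ?F ?G, OF *] show ?thesis by simp
qed

text \<open>The product \<open>T(h) l(h)\<close> is constant: substitute \<open>w(g, 1) = l(1)\<close> into the previous identity at the unit of \<open>A\<close>.\<close>

lemma fusion_functional_constant:
  "fusion_functional (p, q, False) =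
   fusion_functional (False, False, False) * left_scalar False False / left_scalar p q"
proof -
  have "w ((p, q, False), (False, False, False)) = left_scalar False False"
    using left_scalar_mult[of p q False False] left_scalar_nonzero[of p q] by simp
  then have "fusion_functional (False, False, False) * left_scalar False False = left_scalar p q * fusion_functional (p, q, False)"
    using fusion_functional_mult[of False False p q] by simp
  then show ?thesis using left_scalar_nonzero[of p q] by (simp add: field_simps)
qed

lemma w_eq_cobound:
  obtains v where "block_scalar v" "\<And>i. v i \<noteq> 0" "w = cobound v"
proof -
  define \<tau> where "\<tau> = fusion_functional (False, False, False) * left_scalar False False"
  have T: "fusion_functional (p, q, False) = \<tau> * inverse (left_scalar p q)" for p q
    unfolding \<tau>_def by (subst fusion_functional_constant) (simp only: divide_inverse)
  have "\<tau> \<noteq> 0"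
  proof
    assume "\<tau> = 0"
    then have "fusion_functional (p, q, False) = 0" for p q by (simp add: T)
    then show False using w_block_block_nonzero by (simp only: w_block_block prod_val_simps) simp
  qed
  \<comment> \<open>On the \<open>M\<^sub>2 \<otimes> M\<^sub>2\<close> block the coboundary of \<open>v\<close> carries the square of the block scalar, which has to be \<open>\<tau>\<close>.\<close>
  define v where "v = (\<lambda>(i, j, k). if k then csqrt \<tau> else left_scalar i j)"
  have v: "v (i, j, False) = left_scalar i j" "v (i, j, True) = csqrt \<tau>" for i j
    by (simp_all add: v_def)
  have sq: "csqrt \<tau> * csqrt \<tau> = \<tau>"
    by (metis power2_csqrt power2_eq_square)
  have group_group: "w ((i, j, False), (p, q, False)) = left_scalar i j * left_scalar p q * inverse (left_scalar (i \<noteq> p) (j \<noteq> q))" for i j p q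
    using left_scalar_mult[of i j p q] left_scalar_nonzero[of "i \<noteq> p" "j \<noteq> q"]
    by (metis divide_inverse nonzero_eq_divide_eq)
  have "w ((p, q, True), (r, s, True)) = cobound v ((p, q, True), (r, s, True))" for p q r s
    by (simp only: cobound_def split v sq w_block_block prod_val_simps T) (simp add: algebra_simps)
  moreover have "csqrt \<tau> \<noteq> 0" using \<open>\<tau> \<noteq> 0\<close> by simp
  ultimately have "w (i, j) = cobound v (i, j)" for i j
    by (cases i rule: kp_index_cases; cases j rule: kp_index_cases)
      (simp_all add: cobound_def v group_group w_group_block w_block_group left_eq_right_scalar)
  then have "w = cobound v" by (simp add: fun_eq_iff split_paired_all)
  moreover have "block_scalar v" by (auto simp: block_scalar_def v)
  moreover have "v i \<noteq> 0" for i
    using left_scalar_nonzero \<open>\<tau> \<noteq> 0\<close> by (cases i) (simp add: v_def)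
  ultimately show ?thesis using that by blast
qed

end

section \<open>The quotient groups\<close>

lemma block_scalar_const: "block_scalar (\<lambda>_. c)"
  by (simp add: block_scalar_def)

text \<open>
  Every coset \<open>H #> a\<close> with \<open>a\<close> in \<open>G\<close> is \<open>H\<close> itself, because \<open>a\<close> lies in the group \<open>H\<close>. With \<open>G\<close> the invariant
  cocycles and \<open>H\<close> the coboundaries, this turns triviality of the quotient into the inclusion \<open>G \<subseteq> H\<close>.
\<close>

lemma trivial_group_Mod:
  assumes "group (G\<lparr>carrier := H\<rparr>)" "carrier G \<subseteq> H" "carrier G \<noteq> {}"
  shows "trivial_group (G Mod H)"
proof -
  interpret H: group "G\<lparr>carrier := H\<rparr>" by (rule assms(1))
  have coset: "H #>\<^bsub>G\<^esub> a = H" if "a \<in> H" for a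
  proof -
    have "h = (h \<otimes>\<^bsub>G\<^esub> (inv\<^bsub>G\<lparr>carrier := H\<rparr>\<^esub> a)) \<otimes>\<^bsub>G\<^esub> a" if "h \<in> H" for h
      using that \<open>a \<in> H\<close> H.m_assoc[of h "inv\<^bsub>G\<lparr>carrier := H\<rparr>\<^esub> a" a] H.inv_closed[of a] H.l_inv[of a]
        H.r_one[of h] by simp
    moreover have "h \<otimes>\<^bsub>G\<^esub> (inv\<^bsub>G\<lparr>carrier := H\<rparr>\<^esub> a) \<in> H" if "h \<in> H" for h
      using that \<open>a \<in> H\<close> H.m_closed H.inv_closed[of a] by simp
    ultimately show ?thesis
      using \<open>a \<in> H\<close> H.m_closed by (fastforce simp: r_coset_def)
  qed
  have "rcosets\<^bsub>G\<^esub> H = {H}"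
    using assms(2,3) coset by (auto simp: RCOSETS_def)
  moreover have "H <#>\<^bsub>G\<^esub> H = H"
  proof -
    have "H <#>\<^bsub>G\<^esub> H = (\<Union>a\<in>H. H #>\<^bsub>G\<^esub> a)" by (auto simp: set_mult_def r_coset_def)
    then show ?thesis using coset H.one_closed by auto
  qed
  ultimately have "G Mod H = \<lparr>carrier = {H}, mult = set_mult G, one = H\<rparr>" "H <#>\<^bsub>G\<^esub> H = H"
    by (simp_all add: FactGroup_def)
  then show ?thesis
    unfolding trivial_group_def by (auto intro!: groupI)
qed

text \<open>
  On central elements the coboundary map is a homomorphism for pointwise multiplication, so the group laws are
  those of pointwise multiplication.
\<close>

lemma cobound_group:
  assumes V: "\<And>v. v \<in> V \<Longrightarrow> block_scalar v" "\<And>v i. v \<in> V \<Longrightarrow> v i \<noteq> 0"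
    and closed: "(\<lambda>_. 1) \<in> V" "\<And>u v. u \<in> V \<Longrightarrow> v \<in> V \<Longrightarrow> (\<lambda>i. u i * v i) \<in> V"
      "\<And>v. v \<in> V \<Longrightarrow> (\<lambda>i. inverse (v i)) \<in> V"
  shows "group ((mult_monoid (tensor_alg kp_dual kp_dual))\<lparr>carrier := cobound ` V\<rparr>)"
proof (rule groupI)
  let ?G = "(mult_monoid (tensor_alg kp_dual kp_dual))\<lparr>carrier := cobound ` V\<rparr>"
  have mult: "cobound u \<otimes>\<^bsub>?G\<^esub> cobound v = cobound (\<lambda>i. u i * v i)" if "u \<in> V" "v \<in> V" for u v
    using that V by (simp add: cobound_mult)
  have one: "\<one>\<^bsub>?G\<^esub> = cobound (\<lambda>_. 1)" by (simp add: unit_dual_tensor cobound_one)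
  show "\<one>\<^bsub>?G\<^esub> \<in> carrier ?G" unfolding one using closed by simp
  fix x assume "x \<in> carrier ?G"
  then obtain u where u: "u \<in> V" "x = cobound u" by auto
  show "\<one>\<^bsub>?G\<^esub> \<otimes>\<^bsub>?G\<^esub> x = x" unfolding one u mult[OF closed(1) u(1)] by simp
  have "cobound (\<lambda>i. inverse (u i)) \<otimes>\<^bsub>?G\<^esub> x = \<one>\<^bsub>?G\<^esub>"
    unfolding one u mult[OF closed(3)[OF u(1)] u(1)] using V(2)[OF u(1)] by simp
  then show "\<exists>y\<in>carrier ?G. y \<otimes>\<^bsub>?G\<^esub> x = \<one>\<^bsub>?G\<^esub>" using closed(3)[OF u(1)] by (intro bexI) auto
  fix y assume "y \<in> carrier ?G"
  then obtain v where v: "v \<in> V" "y = cobound v" by auto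
  show "x \<otimes>\<^bsub>?G\<^esub> y \<in> carrier ?G" unfolding u v mult[OF u(1) v(1)] using closed(2)[OF u(1) v(1)] by simp
  fix z assume "z \<in> carrier ?G"
  then obtain t where t: "t \<in> V" "z = cobound t" by auto
  show "x \<otimes>\<^bsub>?G\<^esub> y \<otimes>\<^bsub>?G\<^esub> z = x \<otimes>\<^bsub>?G\<^esub> (y \<otimes>\<^bsub>?G\<^esub> z)"
    unfolding u v t mult[OF u(1) v(1)] mult[OF v(1) t(1)]
      mult[OF closed(2)[OF u(1) v(1)] t(1)] mult[OF u(1) closed(2)[OF v(1) t(1)]] mult.assoc ..
qed

lemma unitary_block_scalar_iff:
  assumes "block_scalar v"
  shows "unitary kp_dual v \<longleftrightarrow> (\<forall>i. cmod (v i) = 1)"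
proof -
  obtain \<mu> where \<mu>: "\<And>i j. v (i, j, True) = \<mu>" using assms by (auto simp: block_scalar_def)
  have "alg_star kp_dual v = (\<lambda>i. cnj (v i))"
    by (auto simp: fun_eq_iff alg_star_dual \<mu>)
  moreover have "c * cnj c = 1 \<longleftrightarrow> cmod c = 1" for c
  proof -
    have "c * cnj c = 1 \<longleftrightarrow> (cmod c)\<^sup>2 = 1"
      unfolding complex_norm_square[symmetric] by (simp only: of_real_eq_1_iff flip: of_real_power)
    then show ?thesis by (simp add: abs_square_eq_1)
  qed
  ultimately show ?thesis
    using assms by (simp add: unitary_def unit_dual alg_mult_block_scalar fun_eq_iff mult.commute)
qed

text \<open>
  With \<open>n = v\<^sup>* v\<close>, unitarity says that the coboundary of \<open>n\<close> is 1. Its scalar on \<open>g \<otimes> m\<close> is \<open>n(g)\<close>, so \<open>n(g) = 1\<close>; then its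
  scalar on \<open>m \<otimes> m\<close> is the square of the block scalar of \<open>n\<close>. As \<open>n\<close> is nonnegative, \<open>n = 1\<close>.
\<close>

lemma unitary_cobound:
  assumes v: "block_scalar v" and u: "unitary (tensor_alg kp_dual kp_dual) (cobound v)"
  shows "cmod (v i) = 1"
proof -
  define n where "n i = cnj (v i) * v i" for i
  have n: "n i = of_real ((cmod (v i))\<^sup>2)" for i
    unfolding n_def by (metis complex_norm_square mult.commute)
  obtain \<mu> where \<mu>: "\<And>i j. v (i, j, True) = \<mu>" using v by (auto simp: block_scalar_def)
  have "alg_mult (tensor_alg kp_dual kp_dual) (cobound (\<lambda>i. cnj (v i))) (cobound v) = cobound n"
    unfolding n_def by (rule cobound_mult) (use v block_scalar_comp in auto)
  then have one: "cobound n = (\<lambda>_. 1)"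
    using u v by (simp add: unitary_def cobound_star unit_dual_tensor)
  obtain \<nu> where \<nu>: "n (i, j, True) = \<nu>" for i j
    using \<mu> by (simp add: n_def)
  have "\<nu> \<noteq> 0"
    using fun_cong[OF one, of "((False, False, True), (False, False, True))"] by (auto simp: cobound_def \<nu>)
  then have n1: "n (i, j, False) = 1" for i j
    using fun_cong[OF one, of "((i, j, False), (False, False, True))"] by (simp add: cobound_def \<nu> mult.assoc)
  moreover have "\<nu> * \<nu> = 1"
    using fun_cong[OF one, of "((False, False, True), (False, False, True))"] by (simp add: cobound_def \<nu> n1)
  ultimately have "n i * n i = 1" for i
    by (cases i rule: kp_index_cases) (simp_all add: \<nu>)
  then have "complex_of_real ((cmod (v i))\<^sup>2 * (cmod (v i))\<^sup>2) = 1"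
    by (simp only: n of_real_mult)
  then have "(cmod (v i)) ^ 4 = 1"
    by (simp only: of_real_eq_1_iff flip: power_add) simp
  then show ?thesis using power_eq_imp_eq_base[of "cmod (v i)" 4 1] by simp
qed

lemma carrier_A1: "carrier (A1 kp_dual) = {v. block_scalar v \<and> (\<forall>i. v i \<noteq> 0)}"
  using central_unit_iff by (auto simp: A1_def)

lemma carrier_A1_u: "carrier (A1_u kp_dual) = {v. block_scalar v \<and> (\<forall>i. cmod (v i) = 1)}"
  using unitary_block_scalar_iff central_iff by (auto simp: A1_u_def)

lemma coboundary_A1: "coboundary kp_dual ` carrier (A1 kp_dual) = cobound ` carrier (A1 kp_dual)"
  by (rule image_cong) (auto simp: carrier_A1 coboundary_eq_cobound)

lemma norm_eq_1_nonzero: "cmod c = 1 \<Longrightarrow> c \<noteq> 0"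
  by auto

lemma coboundary_A1_u: "coboundary kp_dual ` carrier (A1_u kp_dual) = cobound ` carrier (A1_u kp_dual)"
  by (rule image_cong) (auto simp: carrier_A1_u norm_eq_1_nonzero intro!: coboundary_eq_cobound)

lemma one_in_A2_u: "(\<lambda>_. 1) \<in> carrier (A2_u kp_dual)"
proof -
  have one: "prod_val (\<lambda>_. 1) i j = 1" for i j
    by (cases i rule: kp_index_cases; cases j rule: kp_index_cases; simp)
  have id: "alg_mult (tensor_alg kp_dual kp_dual) (\<lambda>_. 1) f = f"
    "alg_mult (tensor_alg kp_dual kp_dual) f (\<lambda>_. 1) = f" for f
    by (auto intro!: ext simp: alg_mult_dual_dual sweedler_counit)
  have "id_comult kp_dual (\<lambda>_. 1) = (\<lambda>_. 1)" "comult_id kp_dual (\<lambda>_. 1) = (\<lambda>_. 1)"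
    using one by (auto intro!: ext simp: id_comult_def comult_id_def dual_hopf_def kac_paljutkin_def prod_val_def)
  moreover have "tensor_unit_left kp_dual (\<lambda>_. 1) = (\<lambda>_. 1)" "tensor_unit_right kp_dual (\<lambda>_. 1) = (\<lambda>_. 1)"
    by (auto intro!: ext simp: tensor_unit_left_def tensor_unit_right_def unit_dual)
  ultimately have "two_cocycle kp_dual (\<lambda>_. 1)"
    using id by (auto simp: two_cocycle_def Units_def unit_dual_tensor)
  moreover have "invariant kp_dual (\<lambda>_. 1)"
    by (simp add: invariant_def id)
  moreover have "alg_star (tensor_alg kp_dual kp_dual) (\<lambda>_. 1) = (\<lambda>_. 1)"
    using cobound_star[of "\<lambda>_. 1"] by (simp add: block_scalar_def cobound_one)
  ultimately show ?thesis
    by (simp add: A2_u_def unitary_def unit_dual_tensor id)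
qed

lemma carrier_A2_eq_cobound:
  assumes "w \<in> carrier (A2 kp_dual)"
  obtains v where "block_scalar v" "\<And>i. v i \<noteq> 0" "w = cobound v"
proof -
  have "kp_invariant_cocycle w" using assms by (simp add: A2_def kp_invariant_cocycle_def)
  then show ?thesis using kp_invariant_cocycle.w_eq_cobound that by blast
qed

theorem theorem4p7:
  shows "trivial_group (H2_uinv (dual_hopf kac_paljutkin)) \<and>
         trivial_group (H2_inv (dual_hopf kac_paljutkin))"
proof
  show "trivial_group (H2_uinv kp_dual)"
    unfolding H2_uinv_def
  proof (rule trivial_group_Mod)
    show "group (A2_u kp_dual\<lparr>carrier := coboundary kp_dual ` carrier (A1_u kp_dual)\<rparr>)"
    proof -
      have "group (mult_monoid (tensor_alg kp_dual kp_dual)\<lparr>carrier := cobound ` carrier (A1_u kp_dual)\<rparr>)"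
      proof (rule cobound_group)
        show "v i \<noteq> 0" if "v \<in> carrier (A1_u kp_dual)" for v i
          using that norm_eq_1_nonzero[of "v i"] by (cases i) (auto simp: carrier_A1_u)
      qed (auto simp: carrier_A1_u norm_mult norm_inverse block_scalar_comp block_scalar_mult block_scalar_const)
      then show ?thesis by (simp add: A2_u_def coboundary_A1_u)
    qed
    show "carrier (A2_u kp_dual) \<subseteq> coboundary kp_dual ` carrier (A1_u kp_dual)"
    proof
      fix w assume w: "w \<in> carrier (A2_u kp_dual)"
      then have "w \<in> carrier (A2 kp_dual)" by (simp add: A2_u_def A2_def)
      then obtain v where v: "block_scalar v" "w = cobound v" by (rule carrier_A2_eq_cobound)
      then show "w \<in> coboundary kp_dual ` carrier (A1_u kp_dual)"
        using w unitary_cobound[of v] unfolding coboundary_A1_u unfolding carrier_A1_u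
        by (intro image_eqI[where x = v]) (simp_all add: A2_u_def)
    qed
  qed (use one_in_A2_u in auto)
  show "trivial_group (H2_inv kp_dual)"
    unfolding H2_inv_def
  proof (rule trivial_group_Mod)
    show "group (A2 kp_dual\<lparr>carrier := coboundary kp_dual ` carrier (A1 kp_dual)\<rparr>)"
    proof -
      have "group (mult_monoid (tensor_alg kp_dual kp_dual)\<lparr>carrier := cobound ` carrier (A1 kp_dual)\<rparr>)"
        by (rule cobound_group) (auto simp: carrier_A1 block_scalar_comp block_scalar_mult block_scalar_const)
      then show ?thesis by (simp add: A2_def coboundary_A1)
    qed
    show "carrier (A2 kp_dual) \<subseteq> coboundary kp_dual ` carrier (A1 kp_dual)"
      unfolding coboundary_A1 unfolding carrier_A1 by (auto elim!: carrier_A2_eq_cobound)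
    show "carrier (A2 kp_dual) \<noteq> {}"
      using one_in_A2_u by (auto simp: A2_def A2_u_def)
  qed
qed

end
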